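(* Assume that $F$ is bounded from below on $X_{\mathrm{ad}}\times S(U_{\mathrm{ad}})\times U_{\mathrm{ad}}$, where $S:=A^{-1}B$, and that the partial Fréchet derivatives $F'_x$, $F'_y$, $F'_u$ are Lipschitz continuous on $\mathbb{R}^n\times\mathcal Y\times\mathcal U$. Let $\{(x_k,y_k,u_k)\}_{k}$ be an (infinite) sequence generated by the penalty algorithm described in the context. Then $\{(x_k,y_k,u_k)\}_k$ possesses a weakly convergent subsequence in $\mathbb{R}^n\times\mathcal Y\times\mathcal U$. Moreover, whenever the step size parameter $\eta>0$ of the algorithm is chosen sufficiently small (i.e., there is $\bar\eta>0$ such that the following holds whenever $\eta\in(0,\bar\eta)$), each weak accumulation point of $\{(x_k,y_k,u_k)\}_k$ is a stationary point of the relaxed problem $(\mathrm{IOC}_\varepsilon)$.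
   Context: Setting and standing assumptions. All spaces are real. $\mathcal Y,\mathcal U,\mathcal V$ are Hilbert spaces, $\mathcal Y$ is continuously embedded in $\mathcal V$; $\mathcal U^*$ is identified with $\mathcal U$ and $\mathcal V^*$ with $\mathcal V$ (via Riesz), and $\mathcal Y^{**}$ with $\mathcal Y$; the embedding $\mathcal Y\hookrightarrow\mathcal V$ and its adjoint $\mathcal V\hookrightarrow\mathcal Y^*$ are suppressed in the notation. $F\colon\mathbb{R}^n\times\mathcal Y\times\mathcal U\to\mathbb{R}$ is continuously Fréchet differentiable and convex. $X_{\mathrm{ad}}\subset\mathbb{R}^n$ is nonempty, convex, compact. $A\in\mathcal L(\mathcal Y,\mathcal Y^* )$ is an isomorphism, $B\in\mathcal L(\mathcal U,\mathcal Y^* )$, $E\in\mathcal L(\mathbb{R}^n,\mathcal V)$ (linear continuous operators); so $A^*\in\mathcal L(\mathcal Y,\mathcal Y^* )$, $B^*\in\mathcal L(\mathcal Y,\mathcal U)$, $E^*\in\mathcal L(\mathcal V,\mathbb{R}^n)$. $U_{\mathrm{ad}}\subset\mathcal U$ is nonempty, closed, convex, bounded. $\sigma>0$ and $\varepsilon>0$ are fixed. Set $$f(x,y,u):=\tfrac12\|y-Ex\|_{\mathcal V}^2+\tfrac{\sigma}{2}\|u\|_{\mathcal U}^2,$$ so that $f'_x(x,y,u)=E^*(Ex-y)$, $f'_y(x,y,u)=y-Ex$, $f'_u(x,y,u)=\sigma u$. For $x\in\mathbb{R}^n$, the lower-level problem is $\min_{y,u} f(x,y,u)$ s.t. $Ay=Bu$,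 $u\in U_{\mathrm{ad}}$. It has a unique global minimizer $(y(x),u(x))\in\mathcal Y\times\mathcal U$; $\varphi(x):=f(x,y(x),u(x))$ is its optimal value, and $\varphi$ is continuously differentiable with $\varphi'(x)=E^*(Ex-y(x))$. For a convex set $C$ in a Hilbert space identified with its dual, $N_C(\bar z)=\{z^*: \langle z^*,z-\bar z\rangle\le 0\ \forall z\in C\}$ if $\bar z\in C$, and $N_C(\bar z)=\emptyset$ otherwise; $\operatorname{proj}_C$ is the metric projection. Relaxed problem $(\mathrm{IOC}_\varepsilon)$: minimize $F(x,y,u)$ over $(x,y,u)\in\mathbb{R}^n\times\mathcal Y\times\mathcal U$ s.t. $x\in X_{\mathrm{ad}}$, $Ay=Bu$, $u\in U_{\mathrm{ad}}$, $f(x,y,u)-\varphi(x)\le\varepsilon$. Stationary point of $(\mathrm{IOC}_\varepsilon)$: a feasible point $(\bar x,\bar y,\bar u)$ for which there exist $(\lambda^x,\lambda^p,\lambda^u,\lambda^{\mathrm{vf}})\in\mathbb{R}^n\times\mathcal Y\times\mathcal U\times\mathbb{R}$ with $0=F'_x(\bar x,\bar y,\bar u)+\lambda^x+\lambda^{\mathrm{vf}}[f'_x(\bar x,\bar y,\bar u)-E^*(E\bar x-y(\bar x))]$, $0=F'_y(\bar x,\bar y,\bar u)+A^*\lambda^p+\lambda^{\mathrm{vf}}f'_y(\bar x,\bar y,\bar u)$, $0=F'_u(\bar x,\bar y,\bar u)-B^*\lambda^p+\lambda^u+\lambda^{\mathrm{vf}}f'_u(\bar x,\bar y,\bar u)$,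 $\lambda^x\in N_{X_{\mathrm{ad}}}(\bar x)$, $\lambda^u\in N_{U_{\mathrm{ad}}}(\bar u)$, and $\lambda^{\mathrm{vf}}\ge0$, $f(\bar x,\bar y,\bar u)-\varphi(\bar x)-\varepsilon\le0$, $\lambda^{\mathrm{vf}}\,(f(\bar x,\bar y,\bar u)-\varphi(\bar x)-\varepsilon)=0$. Penalty algorithm. Parameters: $x_0\in X_{\mathrm{ad}}$, $\alpha_0>0$, $\gamma>1$, $\eta>0$, $\kappa\in(0,1)$. Set $V_{-1}:=\infty$. For $k=0,1,2,\dots$: (1) Given $x_k,\alpha_k$, find $(y_k,u_k,\lambda^p_k,\lambda^u_k)\in\mathcal Y\times\mathcal U\times\mathcal Y\times\mathcal U$ with $0=F'_y(x_k,y_k,u_k)+A^*\lambda^p_k+\alpha_kf'_y(x_k,y_k,u_k)$, $0=F'_u(x_k,y_k,u_k)-B^*\lambda^p_k+\lambda^u_k+\alpha_kf'_u(x_k,y_k,u_k)$, $0=Ay_k-Bu_k$, $\lambda^u_k\in N_{U_{\mathrm{ad}}}(u_k)$. (2) Compute $y(x_k)$, $\varphi(x_k)$ and set $V_k:=f(x_k,y_k,u_k)-\varphi(x_k)-\varepsilon$. (3) If $V_k\le0$, stop and return $(x_k,y_k,u_k)$. Otherwise set $\alpha_{k+1}:=\gamma\alpha_k$ if $V_k>\kappa V_{k-1}$, and $\alpha_{k+1}:=\alpha_k$ if not. (4) Set $w_k:=F'_x(x_k,y_k,u_k)+\alpha_{k+1}\bigl(f'_x(x_k,y_k,u_k)-E^*(Ex_k-y(x_k))\bigr)$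 and $x_{k+1}:=\operatorname{proj}_{X_{\mathrm{ad}}}(x_k-\eta w_k)$. A "sequence generated by the algorithm" means an infinite one, i.e., the algorithm does not stop in step (3). *)

theory Defs
  imports "HOL-Analysis.Analysis"
begin

section \<open>Hilbert space notions\<close>

text \<open>Hilbert spaces are types of the sort \<open>{real_inner, complete_space}\<close>; the dual of a space
  of type \<^typ>\<open>'a\<close> is the type \<open>'a \<Rightarrow>\<^sub>L real\<close>.\<close>

lemma min_norm_unique_exists:
  fixes S :: "'a::{real_inner,complete_space} set"
  assumes "closed S" "convex S" "S \<noteq> {}"
  shows "\<exists>!a. a \<in> S \<and> (\<forall>b\<in>S. norm a \<le> norm b)"
proof -
  define d where "d = Inf (norm ` S)"
  have bdd: "bdd_below (norm ` S)" by (rule bdd_belowI[of _ 0]) auto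
  have dle: "d \<le> norm a" if "a \<in> S" for a
    unfolding d_def using that bdd by (simp add: cInf_lower)
  have d0: "0 \<le> d" unfolding d_def using assms(3) by (intro cInf_greatest) auto
  have par: "(norm (a - b))\<^sup>2 \<le> 2 * (norm a)\<^sup>2 + 2 * (norm b)\<^sup>2 - 4 * d\<^sup>2"
    if "a \<in> S" "b \<in> S" for a b
  proof -
    have "(1/2) *\<^sub>R a + (1/2) *\<^sub>R b \<in> S"
      using convexD[OF assms(2) that, of "1/2" "1/2"] by simp
    hence "d\<^sup>2 \<le> (norm ((1/2) *\<^sub>R a + (1/2) *\<^sub>R b))\<^sup>2"
      using dle d0 power_mono by blast
    moreover have "4 * (norm ((1/2) *\<^sub>R a + (1/2) *\<^sub>R b))\<^sup>2 + (norm (a - b))\<^sup>2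
        = 2 * (norm a)\<^sup>2 + 2 * (norm b)\<^sup>2"
      unfolding power2_norm_eq_inner by (simp add: inner_simps inner_commute algebra_simps)
    ultimately show ?thesis by linarith
  qed
  have "\<exists>a\<in>S. norm a < d + inverse (real (Suc n))" for n
  proof -
    have "Inf (norm ` S) < d + inverse (real (Suc n))" unfolding d_def by simp
    thus ?thesis using cInf_lessD[of "norm ` S"] assms(3) by auto
  qed
  then obtain s where s: "\<And>n. s n \<in> S" "\<And>n. norm (s n) < d + inverse (real (Suc n))" by metis
  have lim: "(\<lambda>n. norm (s n)) \<longlonglongrightarrow> d"
  proof (rule tendsto_sandwich[of "\<lambda>_. d" _ _ "\<lambda>n. d + inverse (real (Suc n))"])
    show "(\<lambda>n. d + inverse (real (Suc n))) \<longlonglongrightarrow> d"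
      using tendsto_add[OF tendsto_const[of d] LIMSEQ_inverse_real_of_nat] by simp
  qed (use s dle in \<open>auto intro!: always_eventually less_imp_le\<close>)
  have lim2: "(\<lambda>n. (norm (s n))\<^sup>2) \<longlonglongrightarrow> d\<^sup>2" by (intro tendsto_power lim)
  have "Cauchy s"
  proof (rule CauchyI)
    fix e :: real assume e: "e > 0"
    have "\<forall>\<^sub>F n in sequentially. (norm (s n))\<^sup>2 < d\<^sup>2 + e\<^sup>2 / 4"
      using e by (intro order_tendstoD(2)[OF lim2]) simp
    then obtain N where N: "\<And>n. n \<ge> N \<Longrightarrow> (norm (s n))\<^sup>2 < d\<^sup>2 + e\<^sup>2 / 4"
      by (auto simp: eventually_sequentially)
    have "norm (s m - s n) < e" if "m \<ge> N" "n \<ge> N" for m n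
    proof -
      have "(norm (s m - s n))\<^sup>2 < e\<^sup>2"
        using par[OF s(1) s(1), of m n] N[OF that(1)] N[OF that(2)] by linarith
      thus ?thesis using e by (simp add: power2_less_imp_less)
    qed
    thus "\<exists>M. \<forall>m\<ge>M. \<forall>n\<ge>M. norm (s m - s n) < e" by blast
  qed
  then obtain a where a: "s \<longlonglongrightarrow> a" using Cauchy_convergent convergent_def by blast
  have aS: "a \<in> S" using assms(1) s(1) a closed_sequentially by blast
  have na: "norm a = d" using LIMSEQ_unique[OF tendsto_norm[OF a] lim] .
  show ?thesis
  proof (rule ex1I[of _ a])
    show "a \<in> S \<and> (\<forall>b\<in>S. norm a \<le> norm b)" using aS na dle by auto
  next
    fix b assume b: "b \<in> S \<and> (\<forall>c\<in>S. norm b \<le> norm c)"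
    hence "norm b = d" using aS na dle by (metis order_antisym)
    hence "(norm (b - a))\<^sup>2 \<le> 0" using par[of b a] b aS na by simp
    thus "b = a" by simp
  qed
qed

lemma riesz_representation:
  fixes l :: "'a::{real_inner,complete_space} \<Rightarrow> real"
  assumes "bounded_linear l"
  shows "\<exists>!w. \<forall>h. w \<bullet> h = l h"
proof -
  interpret bounded_linear l by fact
  have "\<exists>w. \<forall>h. w \<bullet> h = l h"
  proof (cases "\<forall>h. l h = 0")
    case True
    thus ?thesis by (intro exI[of _ 0]) simp
  next
    case False
    then obtain h0 where h0: "l h0 \<noteq> 0" by blast
    define S where "S = {h. l h = 1}"
    have cl: "closed S" unfolding S_def
      by (intro closed_Collect_eq continuous_intros linear_continuous_on[OF assms])
    have cv: "convex S" unfolding S_def convex_def by (auto simp: add scaleR)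
    have "(1 / l h0) *\<^sub>R h0 \<in> S" using h0 by (simp add: S_def scaleR)
    then obtain a where a: "a \<in> S" "\<And>b. b \<in> S \<Longrightarrow> norm a \<le> norm b"
      using min_norm_unique_exists[OF cl cv] by blast
    have la: "l a = 1" using a by (simp add: S_def)
    hence a0: "a \<bullet> a \<noteq> 0" using zero by auto
    have orth: "a \<bullet> k = 0" if k: "l k = 0" for k
    proof (cases "k = 0")
      case False
      define t where "t = (a \<bullet> k) / (k \<bullet> k)"
      have "a - t *\<^sub>R k \<in> S" by (simp add: S_def diff scaleR la k)
      hence "(norm a)\<^sup>2 \<le> (norm (a - t *\<^sub>R k))\<^sup>2" using a(2) power_mono norm_ge_zero by blast
      also have "\<dots> = (norm a)\<^sup>2 - (a \<bullet> k)\<^sup>2 / (k \<bullet> k)"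
        using False unfolding power2_norm_eq_inner t_def
        by (simp add: inner_simps inner_commute field_simps power2_eq_square)
      finally have "(a \<bullet> k)\<^sup>2 / (k \<bullet> k) \<le> 0" by simp
      moreover have "k \<bullet> k > 0" using False by simp
      ultimately show ?thesis by (simp add: divide_le_0_iff)
    qed simp
    have "((1 / (a \<bullet> a)) *\<^sub>R a) \<bullet> h = l h" for h
    proof -
      have "a \<bullet> (h - l h *\<^sub>R a) = 0" by (rule orth) (simp add: diff scaleR la)
      thus ?thesis using a0 by (simp add: inner_simps field_simps)
    qed
    thus ?thesis by blast
  qed
  moreover have "w = w'" if "\<forall>h. w \<bullet> h = l h" "\<forall>h. w' \<bullet> h = l h" for w w'
  proof -
    have "(w - w') \<bullet> (w - w') = 0"
      unfolding inner_diff_left[of w w'] using that by simp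
    thus ?thesis by simp
  qed
  ultimately show ?thesis by blast
qed

definition gradient :: "('a::real_inner \<Rightarrow> real) \<Rightarrow> 'a \<Rightarrow> 'a" where
  "gradient g x = (THE D. GDERIV g x :> D)"

lemma gradient_eqI:
  fixes g :: "'a::real_inner \<Rightarrow> real"
  assumes "GDERIV g x :> D"
  shows "gradient g x = D"
  unfolding gradient_def
proof (rule the_equality)
  fix D' assume "GDERIV g x :> D'"
  hence "(\<lambda>h. h \<bullet> D') = (\<lambda>h. h \<bullet> D)"
    using assms has_derivative_unique unfolding gderiv_def by blast
  hence "(D' - D) \<bullet> D' = (D' - D) \<bullet> D" by meson
  hence "(D' - D) \<bullet> (D' - D) = 0" by (simp add: inner_diff_right)
  thus "D' = D" by simp
qed (fact assms)

lemma GDERIV_gradient: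
  fixes g :: "'a::{real_inner,complete_space} \<Rightarrow> real"
  assumes "g differentiable (at x)"
  shows "GDERIV g x :> gradient g x"
proof -
  obtain g' where g': "(g has_derivative g') (at x)"
    using assms by (auto simp: differentiable_def)
  obtain w where "\<forall>h. w \<bullet> h = g' h"
    using riesz_representation[OF has_derivative_bounded_linear[OF g']] by blast
  hence "g' = (\<lambda>h. h \<bullet> w)" by (auto simp: inner_commute)
  hence "GDERIV g x :> w" using g' by (simp add: gderiv_def)
  thus ?thesis using gradient_eqI by metis
qed

text \<open>Partial derivatives of a functional on a product of three spaces. The first and the third
  space are identified with their duals, the second one is not.\<close>

definition partial_x ::
    "('x::real_inner \<times> 'y::real_normed_vector \<times> 'u::real_inner \<Rightarrow> real) \<Rightarrow> 'x \<times> 'y \<times> 'u \<Rightarrow> 'x" where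
  "partial_x g = (\<lambda>(x, y, u). gradient (\<lambda>x'. g (x', y, u)) x)"

definition partial_y ::
    "('x::real_inner \<times> 'y::real_normed_vector \<times> 'u::real_inner \<Rightarrow> real) \<Rightarrow> 'x \<times> 'y \<times> 'u \<Rightarrow> 'y \<Rightarrow>\<^sub>L real" where
  "partial_y g = (\<lambda>(x, y, u). Blinfun (frechet_derivative (\<lambda>y'. g (x, y', u)) (at y)))"

definition partial_u ::
    "('x::real_inner \<times> 'y::real_normed_vector \<times> 'u::real_inner \<Rightarrow> real) \<Rightarrow> 'x \<times> 'y \<times> 'u \<Rightarrow> 'u" where
  "partial_u g = (\<lambda>(x, y, u). gradient (\<lambda>u'. g (x, y, u')) u)"

definition continuously_Frechet_differentiable ::
    "('a::real_normed_vector \<Rightarrow> 'b::real_normed_vector) \<Rightarrow> bool" where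
  "continuously_Frechet_differentiable g \<longleftrightarrow>
     (\<exists>g' :: 'a \<Rightarrow> 'a \<Rightarrow>\<^sub>L 'b. (\<forall>z. (g has_derivative blinfun_apply (g' z)) (at z)) \<and>
        continuous_on UNIV g')"

definition is_isomorphism :: "('a::real_normed_vector \<Rightarrow>\<^sub>L 'b::real_normed_vector) \<Rightarrow> bool" where
  "is_isomorphism T \<longleftrightarrow> (\<exists>R. R o\<^sub>L T = id_blinfun \<and> T o\<^sub>L R = id_blinfun)"

definition normal_cone :: "'a::real_inner set \<Rightarrow> 'a \<Rightarrow> 'a set" where
  "normal_cone C z = (if z \<in> C then {s. \<forall>c\<in>C. s \<bullet> (c - z) \<le> 0} else {})"

definition weakly_converges :: "(nat \<Rightarrow> 'a::real_normed_vector) \<Rightarrow> 'a \<Rightarrow> bool" where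
  "weakly_converges s l \<longleftrightarrow>
     (\<forall>g :: 'a \<Rightarrow>\<^sub>L real. (\<lambda>k. blinfun_apply g (s k)) \<longlonglongrightarrow> blinfun_apply g l)"

text \<open>Accumulation points are understood sequentially.\<close>

definition weak_accumulation_point :: "(nat \<Rightarrow> 'a::real_normed_vector) \<Rightarrow> 'a \<Rightarrow> bool" where
  "weak_accumulation_point s l \<longleftrightarrow>
     (\<exists>r :: nat \<Rightarrow> nat. strict_mono r \<and> weakly_converges (s \<circ> r) l)"


section \<open>The inverse optimal control problem\<close>

text \<open>The embedding of \<^typ>\<open>'y\<close> into \<^typ>\<open>'v\<close> is the injective bounded operator \<open>J\<close>.
  \<open>B\<close> and \<open>E\<close> are restricted by their types only, so they are not arguments of the locale predicate.\<close>

locale ioc_problem =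
  fixes F :: "(real^'n) \<times> 'y::{real_inner,complete_space} \<times> 'u::{real_inner,complete_space} \<Rightarrow> real"
    and J :: "'y \<Rightarrow>\<^sub>L 'v::{real_inner,complete_space}"
    and A :: "'y \<Rightarrow>\<^sub>L ('y \<Rightarrow>\<^sub>L real)"
    and B :: "'u \<Rightarrow>\<^sub>L ('y \<Rightarrow>\<^sub>L real)"
    and E :: "(real^'n) \<Rightarrow>\<^sub>L 'v"
    and Xad :: "(real^'n) set"
    and Uad :: "'u set"
    and \<sigma> :: real
    and \<epsilon> :: real
  assumes F_C1: "continuously_Frechet_differentiable F"
    and F_convex: "convex_on UNIV F"
    and J_inj: "inj (blinfun_apply J)"
    and Xad: "Xad \<noteq> {}" "convex Xad" "compact Xad"
    and A_iso: "is_isomorphism A"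
    and Uad: "Uad \<noteq> {}" "closed Uad" "convex Uad" "bounded Uad"
    and \<sigma>_pos: "\<sigma> > 0"
    and \<epsilon>_pos: "\<epsilon> > 0"
begin

definition control_to_state :: "'u \<Rightarrow> 'y" where
  "control_to_state u = inv (blinfun_apply A) (B u)"

text \<open>\<open>A\<^sup>*\<close> maps \<^typ>\<open>'y\<close>, identified with its bidual, to the dual of \<^typ>\<open>'y\<close>;
  \<open>B\<^sup>*\<close> and \<open>E\<^sup>*\<close> have values in spaces identified with their duals.\<close>

definition A_adj :: "'y \<Rightarrow> 'y \<Rightarrow>\<^sub>L real" where
  "A_adj p = Blinfun (\<lambda>h. A h p)"

definition B_adj :: "'y \<Rightarrow> 'u" where
  "B_adj p = (THE w. \<forall>h. w \<bullet> h = B h p)"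

definition E_adj :: "'v \<Rightarrow> real^'n" where
  "E_adj = adjoint (blinfun_apply E)"

definition f :: "(real^'n) \<times> 'y \<times> 'u \<Rightarrow> real" where
  "f = (\<lambda>(x, y, u). 1/2 * (norm (J y - E x))\<^sup>2 + \<sigma>/2 * (norm u)\<^sup>2)"

definition lower_feasible :: "('y \<times> 'u) set" where
  "lower_feasible = {(y, u). A y = B u \<and> u \<in> Uad}"

definition lower_solution :: "real^'n \<Rightarrow> 'y \<times> 'u" where
  "lower_solution x =
     (THE z. z \<in> lower_feasible \<and> (\<forall>z'\<in>lower_feasible. f (x, z) \<le> f (x, z')))"

definition y_opt :: "real^'n \<Rightarrow> 'y" where
  "y_opt x = fst (lower_solution x)"

definition \<phi> :: "real^'n \<Rightarrow> real" where
  "\<phi> x = f (x, lower_solution x)"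

definition ioc_feasible :: "(real^'n) \<times> 'y \<times> 'u \<Rightarrow> bool" where
  "ioc_feasible = (\<lambda>(x, y, u). x \<in> Xad \<and> A y = B u \<and> u \<in> Uad \<and> f (x, y, u) - \<phi> x \<le> \<epsilon>)"

text \<open>The term \<open>E\<^sup>* (E x - y(x))\<close> below is the derivative of \<open>\<phi>\<close> at \<open>x\<close>.\<close>

definition stationary_point :: "(real^'n) \<times> 'y \<times> 'u \<Rightarrow> bool" where
  "stationary_point = (\<lambda>(x, y, u). ioc_feasible (x, y, u) \<and>
     (\<exists>(lx :: real^'n) (lp :: 'y) (lu :: 'u) (lvf :: real).
        0 = partial_x F (x, y, u) + lx
              + lvf *\<^sub>R (partial_x f (x, y, u) - E_adj (E x - J (y_opt x))) \<and>
        0 = partial_y F (x, y, u) + A_adj lp + lvf *\<^sub>R partial_y f (x, y, u) \<and>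
        0 = partial_u F (x, y, u) - B_adj lp + lu + lvf *\<^sub>R partial_u f (x, y, u) \<and>
        lx \<in> normal_cone Xad x \<and> lu \<in> normal_cone Uad u \<and>
        lvf \<ge> 0 \<and> f (x, y, u) - \<phi> x - \<epsilon> \<le> 0 \<and> lvf * (f (x, y, u) - \<phi> x - \<epsilon>) = 0))"

text \<open>Infinite runs of the penalty algorithm. \<open>V_prev k\<close> is \<open>V\<^bsub>k-1\<^esub>\<close>, with \<open>V\<^bsub>-1\<^esub> = \<infinity>\<close>;
  the metric projection onto \<open>Xad\<close> is the library's \<^const>\<open>closest_point\<close>.\<close>

definition V :: "(real^'n) \<times> 'y \<times> 'u \<Rightarrow> real" where
  "V = (\<lambda>(x, y, u). f (x, y, u) - \<phi> x - \<epsilon>)"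

definition V_prev :: "(nat \<Rightarrow> (real^'n) \<times> 'y \<times> 'u) \<Rightarrow> nat \<Rightarrow> ereal" where
  "V_prev z k = (case k of 0 \<Rightarrow> \<infinity> | Suc j \<Rightarrow> ereal (V (z j)))"

definition penalty_sequence ::
    "real^'n \<Rightarrow> real \<Rightarrow> real \<Rightarrow> real \<Rightarrow> real \<Rightarrow> (nat \<Rightarrow> (real^'n) \<times> 'y \<times> 'u) \<Rightarrow> bool" where
  "penalty_sequence x0 \<alpha>0 \<gamma> \<eta> \<kappa> z \<longleftrightarrow>
     (\<exists>(x :: nat \<Rightarrow> real^'n) (y :: nat \<Rightarrow> 'y) (u :: nat \<Rightarrow> 'u)
        (\<alpha> :: nat \<Rightarrow> real) (lp :: nat \<Rightarrow> 'y) (lu :: nat \<Rightarrow> 'u) (w :: nat \<Rightarrow> real^'n).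
        (\<forall>k. z k = (x k, y k, u k)) \<and> x 0 = x0 \<and> \<alpha> 0 = \<alpha>0 \<and>
        (\<forall>k. 0 = partial_y F (z k) + A_adj (lp k) + \<alpha> k *\<^sub>R partial_y f (z k) \<and>
             0 = partial_u F (z k) - B_adj (lp k) + lu k + \<alpha> k *\<^sub>R partial_u f (z k) \<and>
             0 = A (y k) - B (u k) \<and>
             lu k \<in> normal_cone Uad (u k) \<and>
             \<not> V (z k) \<le> 0 \<and>
             \<alpha> (Suc k) = (if ereal (V (z k)) > ereal \<kappa> * V_prev z k then \<gamma> * \<alpha> k else \<alpha> k) \<and>
             w k = partial_x F (z k)
                     + \<alpha> (Suc k) *\<^sub>R (partial_x f (z k) - E_adj (E (x k) - J (y_opt (x k)))) \<and>
             x (Suc k) = closest_point Xad (x k - \<eta> *\<^sub>R w k)))"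


subsection \<open>The definitions describe the intended objects\<close>

lemma A_adj_apply: "A_adj p h = A h p"
proof -
  have "bounded_linear (\<lambda>h. blinfun_apply (blinfun_apply A h) p)"
    by (intro bounded_linear_intros)
  thus ?thesis unfolding A_adj_def by (simp add: bounded_linear_Blinfun_apply)
qed

lemma B_adj_inner: "B_adj p \<bullet> h = B h p"
proof -
  have "bounded_linear (\<lambda>h. blinfun_apply (blinfun_apply B h) p)"
    by (intro bounded_linear_intros)
  from theI'[OF riesz_representation[OF this]] show ?thesis unfolding B_adj_def by blast
qed

lemma E_adj_inner: "E_adj v \<bullet> x = v \<bullet> E x"
proof -
  have bl: "bounded_linear (\<lambda>h. v' \<bullet> blinfun_apply E h)" for v'
    by (intro bounded_linear_intros)
  have "\<forall>v'. \<exists>w. \<forall>h. w \<bullet> h = v' \<bullet> E h"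
    using riesz_representation[OF bl] by blast
  then obtain g where g: "\<And>v' h. g v' \<bullet> h = v' \<bullet> E h" by metis
  have "adjoint (blinfun_apply E) = g"
    by (rule adjoint_unique) (metis g inner_commute)
  thus ?thesis unfolding E_adj_def using g by simp
qed

lemma bij_A: "bij (blinfun_apply A)"
proof -
  obtain R where R: "R o\<^sub>L A = id_blinfun" "A o\<^sub>L R = id_blinfun"
    using A_iso by (auto simp: is_isomorphism_def)
  show ?thesis
    by (rule o_bij[of "blinfun_apply R"])
       (use R in \<open>auto simp: fun_eq_iff dest: arg_cong[where f = blinfun_apply]\<close>)
qed

lemma control_to_state_iff: "y = control_to_state u \<longleftrightarrow> A y = B u"
  unfolding control_to_state_def using bij_A by (metis bij_inv_eq_iff)

lemma partial_x_f: "partial_x f (x, y, u) = E_adj (E x - J y)"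
proof -
  have d: "((\<lambda>x'. 1/2 * ((J y - E x') \<bullet> (J y - E x')) + \<sigma>/2 * (u \<bullet> u)) has_derivative
      (\<lambda>h. 1/2 * ((J y - E x) \<bullet> (0 - E h) + (0 - E h) \<bullet> (J y - E x)) + 0)) (at x)"
    by (intro has_derivative_add has_derivative_mult_right has_derivative_inner
        has_derivative_diff has_derivative_const bounded_linear.has_derivative[OF blinfun.bounded_linear_right] has_derivative_ident)
  have eq: "(\<lambda>h. 1/2 * ((J y - E x) \<bullet> (0 - E h) + (0 - E h) \<bullet> (J y - E x)) + 0)
      = (\<lambda>h. h \<bullet> E_adj (E x - J y))"
    by (rule ext) (simp add: inner_commute[of _ "E_adj _"] E_adj_inner, simp add: inner_simps inner_commute)
  from d[unfolded eq] have "GDERIV (\<lambda>x'. f (x', y, u)) x :> E_adj (E x - J y)"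
    unfolding gderiv_def f_def power2_norm_eq_inner case_prod_conv .
  thus ?thesis unfolding partial_x_def case_prod_conv by (rule gradient_eqI)
qed

lemma partial_y_f: "partial_y f (x, y, u) = blinfun_inner_right (J y - E x) o\<^sub>L J"
proof -
  have d: "((\<lambda>y'. 1/2 * ((J y' - E x) \<bullet> (J y' - E x)) + \<sigma>/2 * (u \<bullet> u)) has_derivative
      (\<lambda>h. 1/2 * ((J y - E x) \<bullet> (J h - 0) + (J h - 0) \<bullet> (J y - E x)) + 0)) (at y)"
    by (intro has_derivative_add has_derivative_mult_right has_derivative_inner
        has_derivative_diff has_derivative_const bounded_linear.has_derivative[OF blinfun.bounded_linear_right] has_derivative_ident)
  have eq: "(\<lambda>h. 1/2 * ((J y - E x) \<bullet> (J h - 0) + (J h - 0) \<bullet> (J y - E x)) + 0)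
      = blinfun_apply (blinfun_inner_right (J y - E x) o\<^sub>L J)"
    by (rule ext) (simp add: inner_simps inner_commute)
  from d[unfolded eq] have "((\<lambda>y'. f (x, y', u)) has_derivative
      blinfun_apply (blinfun_inner_right (J y - E x) o\<^sub>L J)) (at y)"
    unfolding f_def power2_norm_eq_inner case_prod_conv .
  from frechet_derivative_at[OF this] show ?thesis
    unfolding partial_y_def case_prod_conv by (metis blinfun_apply_inverse)
qed

lemma partial_u_f: "partial_u f (x, y, u) = \<sigma> *\<^sub>R u"
proof -
  have d: "((\<lambda>u'. 1/2 * ((J y - E x) \<bullet> (J y - E x)) + \<sigma>/2 * (u' \<bullet> u')) has_derivative
      (\<lambda>h. 0 + \<sigma>/2 * (u \<bullet> h + h \<bullet> u))) (at u)"
    by (intro has_derivative_add has_derivative_mult_right has_derivative_inner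
        has_derivative_const has_derivative_ident)
  have eq: "(\<lambda>h. 0 + \<sigma>/2 * (u \<bullet> h + h \<bullet> u)) = (\<lambda>h. h \<bullet> (\<sigma> *\<^sub>R u))"
    by (rule ext) (simp add: inner_commute)
  from d[unfolded eq] have "GDERIV (\<lambda>u'. f (x, y, u')) u :> \<sigma> *\<^sub>R u"
    unfolding gderiv_def f_def power2_norm_eq_inner case_prod_conv .
  thus ?thesis unfolding partial_u_def case_prod_conv by (rule gradient_eqI)
qed

lemma lower_solution_unique_exists:
  "\<exists>!z. z \<in> lower_feasible \<and> (\<forall>z'\<in>lower_feasible. f (x, z) \<le> f (x, z'))"
proof -
  obtain R where R: "R o\<^sub>L A = id_blinfun" "A o\<^sub>L R = id_blinfun"
    using A_iso by (auto simp: is_isomorphism_def)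
  have RA: "R (A y) = y" and AR: "A (R l) = l" for y l
    using R by (metis blinfun_apply_blinfun_compose blinfun_apply_id_blinfun id_apply)+
  define s where "s = sqrt \<sigma>"
  have s: "s > 0" "s\<^sup>2 = \<sigma>" using \<sigma>_pos by (auto simp: s_def)
  define T where "T = (\<lambda>(y, u :: 'u). (J y - E x, s *\<^sub>R u))"
  define C where "C = T ` lower_feasible"
  have LF: "(y, u) \<in> lower_feasible \<longleftrightarrow> y = R (B u) \<and> u \<in> Uad" for y u
    unfolding lower_feasible_def using RA AR by (auto, metis)
  have fT: "f (x, z) = 1/2 * (norm (T z))\<^sup>2" for z
    using s by (cases z) (simp add: f_def T_def norm_Pair power_mult_distrib less_imp_le[OF \<sigma>_pos])
  have C: "(a, b) \<in> C \<longleftrightarrow> a = J (R (B (b /\<^sub>R s))) - E x \<and> b /\<^sub>R s \<in> Uad" for a b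
  proof
    assume "(a, b) \<in> C"
    thus "a = J (R (B (b /\<^sub>R s))) - E x \<and> b /\<^sub>R s \<in> Uad"
      using s(1) by (auto simp: C_def T_def LF)
  next
    assume *: "a = J (R (B (b /\<^sub>R s))) - E x \<and> b /\<^sub>R s \<in> Uad"
    show "(a, b) \<in> C"
      unfolding C_def using s(1) *
      by (intro image_eqI[of _ _ "(R (B (b /\<^sub>R s)), b /\<^sub>R s)"]) (auto simp: T_def LF)
  qed
  have "closed C"
  proof -
    have "C = {p. fst p = J (R (B (snd p /\<^sub>R s))) - E x} \<inter> (\<lambda>p. snd p /\<^sub>R s) -` Uad"
      using C by auto
    moreover have "closed {p. fst p = J (R (B (snd p /\<^sub>R s))) - E x}"
      by (intro closed_Collect_eq continuous_intros)
    moreover have "closed ((\<lambda>p :: 'v \<times> 'u. snd p /\<^sub>R s) -` Uad)"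
      by (intro closed_vimage Uad continuous_intros)
    ultimately show ?thesis by (simp only: closed_Int)
  qed
  moreover have "convex C"
  proof (rule convexI)
    fix p q :: "'v \<times> 'u" and t v :: real
    assume pq: "p \<in> C" "q \<in> C" and t: "0 \<le> t" "0 \<le> v" "t + v = 1"
    obtain a b a' b' where p: "p = (a, b)" and q: "q = (a', b')" by (metis surj_pair)
    have Ex: "E x = t *\<^sub>R E x + v *\<^sub>R E x"
      using t(3) by (metis scaleR_add_left scaleR_one)
    have b: "(t *\<^sub>R b + v *\<^sub>R b') /\<^sub>R s = t *\<^sub>R (b /\<^sub>R s) + v *\<^sub>R (b' /\<^sub>R s)"
      by (simp add: scaleR_add_right mult.commute)
    have "t *\<^sub>R (b /\<^sub>R s) + v *\<^sub>R (b' /\<^sub>R s) \<in> Uad"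
      using pq t unfolding p q C by (intro convexD[OF Uad(3)]) auto
    moreover have "t *\<^sub>R a + v *\<^sub>R a'
        = J (R (B (t *\<^sub>R (b /\<^sub>R s) + v *\<^sub>R (b' /\<^sub>R s)))) - E x"
    proof -
      have aa: "a = J (R (B (b /\<^sub>R s))) - E x" "a' = J (R (B (b' /\<^sub>R s))) - E x"
        using pq unfolding p q C by auto
      have "J (R (B (t *\<^sub>R (b /\<^sub>R s) + v *\<^sub>R (b' /\<^sub>R s))))
          = t *\<^sub>R J (R (B (b /\<^sub>R s))) + v *\<^sub>R J (R (B (b' /\<^sub>R s)))"
        by (simp only: blinfun.add_right blinfun.scaleR_right)
      thus ?thesis unfolding aa scaleR_diff_right using Ex by (simp add: algebra_simps)
    qed
    ultimately show "t *\<^sub>R p + v *\<^sub>R q \<in> C"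
      unfolding p q by (simp only: scaleR_Pair add_Pair C b)
  qed
  moreover have "C \<noteq> {}" using Uad(1) LF unfolding C_def by blast
  ultimately have ex1: "\<exists>!c. c \<in> C \<and> (\<forall>b\<in>C. norm c \<le> norm b)" by (rule min_norm_unique_exists)
  have injT: "z = z'" if "T z = T z'" for z z'
    using that s J_inj by (cases z; cases z') (auto simp: T_def inj_def)
  have le: "f (x, z) \<le> f (x, z') \<longleftrightarrow> norm (T z) \<le> norm (T z')" for z z'
    unfolding fT by (simp add: power2_le_iff_abs_le)
  show ?thesis
  proof -
    from ex1 obtain z where z: "z \<in> lower_feasible"
        "\<forall>z'\<in>lower_feasible. norm (T z) \<le> norm (T z')"
      unfolding C_def by auto
    show ?thesis unfolding le
    proof (rule ex1I[of _ z])
      fix z' assume z': "z' \<in> lower_feasible \<and> (\<forall>b\<in>lower_feasible. norm (T z') \<le> norm (T b))"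
      have "T z \<in> C \<and> (\<forall>b\<in>C. norm (T z) \<le> norm b)" "T z' \<in> C \<and> (\<forall>b\<in>C. norm (T z') \<le> norm b)"
        using z z' by (auto simp: C_def)
      hence "T z' = T z" using ex1 by blast
      thus "z' = z" by (rule injT)
    qed (use z in simp)
  qed
qed

end

end

theory Submission
  imports Defs
begin

text \<open>Step (1) of the algorithm is equivalent to a variational inequality, which by convexity says
  that \<open>(y\<^sub>k, u\<^sub>k)\<close> minimizes \<open>F(x\<^sub>k, \<cdot>) + \<alpha>\<^sub>k f(x\<^sub>k, \<cdot>)\<close> on the lower-level feasible set. Comparison
  with the lower-level solution bounds the \<open>\<alpha>\<^sub>k\<close> by a constant depending on the data only, since
  \<open>V\<^sub>k > 0\<close>. Hence \<open>\<alpha>\<^sub>k\<close> is eventually constant, \<open>= a\<close>, and from then on \<open>V\<^sub>k\<close> decays geometrically.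
  As \<open>f\<close> is strongly convex in \<open>u\<close>, the solutions of the variational inequality are Lipschitz in \<open>x\<close>,
  so they converge strongly whenever the \<open>x\<^sub>k\<close> converge; this replaces weak compactness. For small
  \<open>\<eta>\<close>, the merit function \<open>F + a (f - \<phi>)\<close> decreases along the iteration by a multiple of
  \<open>\<parallel>x\<^sub>k\<^sub>+\<^sub>1 - x\<^sub>k\<parallel>\<^sup>2\<close>, so the steps tend to \<open>0\<close> and all conditions pass to the limit.\<close>

section \<open>Tangents of convex functions, partial derivatives, weak limits, geometric
  sequences\<close>

lemma convex_on_above_tangent:
  fixes g :: "'a::real_normed_vector \<Rightarrow> real"
  assumes "convex_on UNIV g" and "(g has_derivative g') (at a)"
  shows "g b \<ge> g a + g' (b - a)"
proof -
  \<comment> \<open>Restricting \<open>g\<close> to the line through \<open>a\<close> and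
    \<open>b\<close> reduces the claim to the tangent inequality for convex functions of one real
    variable.\<close>
  define h where "h = (\<lambda>t::real. g (a + t *\<^sub>R (b - a)))"
  interpret g': bounded_linear g' by (rule has_derivative_bounded_linear[OF assms(2)])
  have cv: "convex_on UNIV h"
  proof (rule convex_onI)
    fix t s r :: real assume t: "0 < t" "t < 1"
    have "a + ((1 - t) *\<^sub>R s + t *\<^sub>R r) *\<^sub>R (b - a)
        = (1 - t) *\<^sub>R (a + s *\<^sub>R (b - a)) + t *\<^sub>R (a + r *\<^sub>R (b - a))"
      by (simp add: algebra_simps)
    thus "h ((1 - t) *\<^sub>R s + t *\<^sub>R r) \<le> (1 - t) * h s + t * h r"
      unfolding h_def using convex_onD[OF assms(1), of t] t by simp
  qed simp
  have "((\<lambda>t. a + t *\<^sub>R (b - a)) has_derivative (\<lambda>t. t *\<^sub>R (b - a))) (at (0::real))"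
    by (auto intro!: derivative_eq_intros)
  moreover have "(g has_derivative g') (at (a + 0 *\<^sub>R (b - a)))"
    using assms(2) by simp
  ultimately have "((\<lambda>t. g (a + t *\<^sub>R (b - a))) has_derivative (\<lambda>t. g' (t *\<^sub>R (b - a)))) (at 0)"
    by (rule has_derivative_compose)
  moreover have "(\<lambda>t. g' (t *\<^sub>R (b - a))) = (*) (g' (b - a))"
    by (auto simp: g'.scaleR)
  ultimately have "(h has_field_derivative g' (b - a)) (at 0)"
    unfolding h_def has_field_derivative_def by simp
  from convex_on_imp_above_tangent[OF cv _ _ _ this, of 1] show ?thesis
    by (simp add: h_def algebra_simps)
qed

text \<open>By linearity the total derivative is the sum of its restrictions to the three coordinate
  axes, and uniqueness of derivatives identifies each restriction with a partial derivative. This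
  links the partial derivatives of the problem to the tangent inequality of the convex
  \<open>F\<close>.\<close>

lemma differentiable_partials:
  fixes g :: "'x::{real_inner,complete_space} \<times> 'y::real_normed_vector \<times> 'u::{real_inner,complete_space} \<Rightarrow> real"
  assumes "g differentiable (at (x, y, u))"
  shows "(g has_derivative (\<lambda>(a, b, c). partial_x g (x, y, u) \<bullet> a + partial_y g (x, y, u) b
            + partial_u g (x, y, u) \<bullet> c)) (at (x, y, u))"
proof -
  obtain g' where g': "(g has_derivative g') (at (x, y, u))"
    using assms by (auto simp: differentiable_def)
  interpret g': bounded_linear g' by (rule has_derivative_bounded_linear[OF g'])
  have dx: "((\<lambda>x'. g (x', y, u)) has_derivative (\<lambda>h. g' (h, 0, 0))) (at x)"
    by (rule has_derivative_compose[where f = "\<lambda>x'. (x', y, u)"]) (auto intro!: derivative_eq_intros g' simp: zero_prod_def)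
  have dy: "((\<lambda>y'. g (x, y', u)) has_derivative (\<lambda>h. g' (0, h, 0))) (at y)"
    by (rule has_derivative_compose[where f = "\<lambda>y'. (x, y', u)"]) (auto intro!: derivative_eq_intros g' simp: zero_prod_def)
  have du: "((\<lambda>u'. g (x, y, u')) has_derivative (\<lambda>h. g' (0, 0, h))) (at u)"
    by (rule has_derivative_compose[where f = "\<lambda>u'. (x, y, u')"]) (auto intro!: derivative_eq_intros g' simp: zero_prod_def)
  have "GDERIV (\<lambda>x'. g (x', y, u)) x :> partial_x g (x, y, u)"
    unfolding partial_x_def case_prod_conv
    by (rule GDERIV_gradient) (use dx in \<open>auto simp: differentiable_def\<close>)
  hence "(\<lambda>h. h \<bullet> partial_x g (x, y, u)) = (\<lambda>h. g' (h, 0, 0))"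
    unfolding gderiv_def using dx by (rule has_derivative_unique)
  hence px: "partial_x g (x, y, u) \<bullet> h = g' (h, 0, 0)" for h
    by (subst inner_commute) (rule fun_cong)
  have "GDERIV (\<lambda>u'. g (x, y, u')) u :> partial_u g (x, y, u)"
    unfolding partial_u_def case_prod_conv
    by (rule GDERIV_gradient) (use du in \<open>auto simp: differentiable_def\<close>)
  hence "(\<lambda>h. h \<bullet> partial_u g (x, y, u)) = (\<lambda>h. g' (0, 0, h))"
    unfolding gderiv_def using du by (rule has_derivative_unique)
  hence pu: "partial_u g (x, y, u) \<bullet> h = g' (0, 0, h)" for h
    by (subst inner_commute) (rule fun_cong)
  have py: "blinfun_apply (partial_y g (x, y, u)) = (\<lambda>h. g' (0, h, 0))"
    unfolding partial_y_def case_prod_conv frechet_derivative_at[OF dy, symmetric]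
    by (rule bounded_linear_Blinfun_apply) (rule has_derivative_bounded_linear[OF dy])
  have "g' = (\<lambda>(a, b, c). partial_x g (x, y, u) \<bullet> a + partial_y g (x, y, u) b
            + partial_u g (x, y, u) \<bullet> c)"
  proof (rule ext, clarify)
    fix a b c
    have "g' (a, b, c) = g' ((a, 0, 0) + (0, b, 0) + (0, 0, c))" by simp
    also have "\<dots> = g' (a, 0, 0) + g' (0, b, 0) + g' (0, 0, c)" unfolding g'.add ..
    finally show "g' (a, b, c) = partial_x g (x, y, u) \<bullet> a + partial_y g (x, y, u) b
            + partial_u g (x, y, u) \<bullet> c"
      by (simp add: px py pu)
  qed
  thus ?thesis using g' by simp
qed

lemma tendsto_imp_weakly_converges:
  assumes "s \<longlonglongrightarrow> l"
  shows "weakly_converges s l"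
  unfolding weakly_converges_def
  by (intro allI bounded_linear.tendsto[OF blinfun.bounded_linear_right] assms)

text \<open>Testing with the inner product against \<open>l - l'\<close> makes the norm of
  \<open>l - l'\<close> vanish.\<close>

lemma weakly_converges_unique:
  fixes l :: "'a::real_inner"
  assumes "weakly_converges s l" "weakly_converges s l'"
  shows "l = l'"
proof -
  have "blinfun_apply (blinfun_inner_right (l - l')) l = blinfun_apply (blinfun_inner_right (l - l')) l'"
    by (rule LIMSEQ_unique[where X = "\<lambda>k. blinfun_apply (blinfun_inner_right (l - l')) (s k)"])
      (use assms in \<open>simp_all only: weakly_converges_def\<close>)
  hence "(l - l') \<bullet> l = (l - l') \<bullet> l'" by simp
  hence "(l - l') \<bullet> (l - l') = 0" by (simp add: inner_diff_right)
  thus ?thesis by simp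
qed

lemma weakly_converges_fst:
  assumes "weakly_converges s l"
  shows "weakly_converges (\<lambda>k. fst (s k)) (fst l)"
  unfolding weakly_converges_def
proof
  fix g :: "'a \<Rightarrow>\<^sub>L real"
  have "bounded_linear (\<lambda>p :: 'a \<times> 'b. g (fst p))" by (intro bounded_linear_intros)
  note eq = bounded_linear_Blinfun_apply[OF this]
  show "(\<lambda>k. g (fst (s k))) \<longlonglongrightarrow> g (fst l)"
    using assms[unfolded weakly_converges_def, rule_format, of "Blinfun (\<lambda>p. g (fst p))"]
    unfolding eq .
qed

text \<open>The inner products with basis vectors are functionals, so weak convergence gives
  convergence of every coordinate. It makes the \<open>x\<close>-component of a weak limit a strong
  limit.\<close>

lemma weakly_converges_imp_tendsto:
  fixes s :: "nat \<Rightarrow> 'a::euclidean_space"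
  assumes "weakly_converges s l"
  shows "s \<longlonglongrightarrow> l"
proof (subst tendsto_componentwise_iff, intro ballI)
  fix i :: 'a
  have "(\<lambda>k. blinfun_inner_right i (s k)) \<longlonglongrightarrow> blinfun_inner_right i l"
    using assms by (simp only: weakly_converges_def)
  thus "(\<lambda>k. s k \<bullet> i) \<longlonglongrightarrow> l \<bullet> i" by (simp add: inner_commute)
qed

text \<open>Every proper increase is at least \<open>(\<gamma> - 1) * \<alpha> 0\<close>, whereas
  the increments of a bounded increasing sequence tend to zero; hence increases stop.\<close>

lemma geometric_steps_eventually_constant:
  fixes \<alpha> :: "nat \<Rightarrow> real"
  assumes pos: "\<alpha> 0 > 0" and \<gamma>: "\<gamma> > 1" and step: "\<And>k. \<alpha> (Suc k) = \<alpha> k \<or> \<alpha> (Suc k) = \<gamma> * \<alpha> k"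
    and bdd: "\<And>k. \<alpha> k \<le> M"
  obtains K where "\<And>k. k \<ge> K \<Longrightarrow> \<alpha> k = \<alpha> K"
proof -
  have ge: "\<alpha> k \<ge> \<alpha> 0 \<and> \<alpha> (Suc k) \<ge> \<alpha> k" for k
  proof (induction k)
    case 0
    show ?case using step[of 0] pos \<gamma> by auto
  next
    case (Suc k)
    have "\<alpha> (Suc k) > 0" using Suc pos by linarith
    hence "\<alpha> (Suc (Suc k)) \<ge> \<alpha> (Suc k)" using step[of "Suc k"] \<gamma> by auto
    thus ?case using Suc by linarith
  qed
  hence "incseq \<alpha>" by (simp add: incseq_SucI)
  then obtain a where a: "\<alpha> \<longlonglongrightarrow> a" using incseq_convergent bdd by metis
  have "(\<lambda>k. \<alpha> (Suc k) - \<alpha> k) \<longlonglongrightarrow> a - a" by (rule tendsto_diff[OF LIMSEQ_Suc[OF a] a])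
  moreover have "a - a < (\<gamma> - 1) * \<alpha> 0" using pos \<gamma> by simp
  ultimately have "\<forall>\<^sub>F k in sequentially. \<alpha> (Suc k) - \<alpha> k < (\<gamma> - 1) * \<alpha> 0" by (rule order_tendstoD(2))
  then obtain K where K: "\<And>k. k \<ge> K \<Longrightarrow> \<alpha> (Suc k) - \<alpha> k < (\<gamma> - 1) * \<alpha> 0"
    by (auto simp: eventually_sequentially)
  have const: "\<alpha> (Suc k) = \<alpha> k" if "k \<ge> K" for k
  proof (rule ccontr)
    assume "\<alpha> (Suc k) \<noteq> \<alpha> k"
    hence "\<alpha> (Suc k) - \<alpha> k = (\<gamma> - 1) * \<alpha> k" using step[of k] by (auto simp: algebra_simps)
    moreover have "(\<gamma> - 1) * \<alpha> k \<ge> (\<gamma> - 1) * \<alpha> 0" using ge[of k] \<gamma> by (intro mult_left_mono) auto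
    ultimately show False using K[OF that] by simp
  qed
  have "\<alpha> k = \<alpha> K" if "k \<ge> K" for k
    using that by (induction k rule: dec_induct) (auto simp: const)
  thus ?thesis by (rule that)
qed

context ioc_problem
begin

subsection \<open>The variational inequality for the lower-level variables\<close>

lemma F_differentiable: "F differentiable (at z)"
  using F_C1 unfolding continuously_Frechet_differentiable_def differentiable_def by blast

lemma F_continuous: "continuous_on S F"
  by (intro continuous_at_imp_continuous_on ballI differentiable_imp_continuous_within F_differentiable)

lemma F_above_tangent:
  "F (x', y', u') \<ge> F (x, y, u) + partial_x F (x, y, u) \<bullet> (x' - x)
      + partial_y F (x, y, u) (y' - y) + partial_u F (x, y, u) \<bullet> (u' - u)"
  using convex_on_above_tangent[OF F_convex
      differentiable_partials[OF F_differentiable[of "(x, y, u)"]], of "(x', y', u')"]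
  by simp

text \<open>The descent inequality. Convexity bounds \<open>F\<close> at the new point by means of
  the gradient there, and Lipschitz continuity replaces this gradient by the one at the old point;
  hence the constant \<open>L\<close> rather than \<open>L/2\<close>.\<close>

lemma F_x_upper_bound:
  assumes "L-lipschitz_on UNIV (partial_x F)"
  shows "F (x', y, u) \<le> F (x, y, u) + partial_x F (x, y, u) \<bullet> (x' - x) + L * (norm (x' - x))\<^sup>2"
proof -
  have "F (x, y, u) \<ge> F (x', y, u) - partial_x F (x', y, u) \<bullet> (x' - x)"
    using F_above_tangent[of x' y u x y u] by (simp add: inner_diff_right)
  moreover have "(partial_x F (x', y, u) - partial_x F (x, y, u)) \<bullet> (x' - x) \<le> L * (norm (x' - x))\<^sup>2"
  proof -
    have "norm (partial_x F (x', y, u) - partial_x F (x, y, u)) \<le> L * norm ((x', y, u) - (x, y, u))"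
      by (rule lipschitz_on_normD[OF assms]) auto
    also have "norm ((x', y, u) - (x, y, u)) = norm (x' - x)" by (simp add: norm_Pair)
    finally have "norm (partial_x F (x', y, u) - partial_x F (x, y, u)) * norm (x' - x)
        \<le> L * norm (x' - x) * norm (x' - x)"
      by (rule mult_right_mono) simp
    thus ?thesis
      using norm_cauchy_schwarz[of "partial_x F (x', y, u) - partial_x F (x, y, u)" "x' - x"]
      by (simp add: power2_eq_square)
  qed
  ultimately show ?thesis by (simp add: inner_diff_left)
qed

text \<open>\<open>f\<close> is quadratic, so its second-order expansion is exact. The nonnegative
  squares give convexity, and the last one gives strong convexity in \<open>u\<close>.\<close>

lemma f_expansion:
  "f (x', y', u') = f (x, y, u) - (J y - E x) \<bullet> E (x' - x) + (J y - E x) \<bullet> J (y' - y)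
      + \<sigma> * (u \<bullet> (u' - u)) + 1/2 * (norm (J (y' - y) - E (x' - x)))\<^sup>2 + \<sigma>/2 * (norm (u' - u))\<^sup>2"
  unfolding f_def case_prod_conv power2_norm_eq_inner blinfun.diff_right
  by (simp add: inner_simps inner_commute algebra_simps)

text \<open>The variational inequality characterising the minimizers of \<open>\<beta> F(x, \<cdot>) + \<alpha> f(x, \<cdot>)\<close> on the
  lower-level feasible set. Step (1) of the algorithm is the case \<open>\<beta> = 1\<close>, the lower-level problem
  is the case \<open>\<beta> = 0\<close>, \<open>\<alpha> = 1\<close>.\<close>

definition penalty_vi :: "real \<Rightarrow> real \<Rightarrow> real^'n \<Rightarrow> 'y \<times> 'u \<Rightarrow> bool" where
  "penalty_vi \<beta> \<alpha> x = (\<lambda>(y, u). (y, u) \<in> lower_feasible \<and>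
     (\<forall>(y', u') \<in> lower_feasible.
        0 \<le> \<beta> * (partial_y F (x, y, u) (y' - y) + partial_u F (x, y, u) \<bullet> (u' - u))
             + \<alpha> * ((J y - E x) \<bullet> J (y' - y) + \<sigma> * (u \<bullet> (u' - u)))))"

lemma penalty_viD:
  assumes "penalty_vi \<beta> \<alpha> x (y, u)" "A y' = B u'" "u' \<in> Uad"
  shows "0 \<le> \<beta> * (partial_y F (x, y, u) (y' - y) + partial_u F (x, y, u) \<bullet> (u' - u))
             + \<alpha> * ((J y - E x) \<bullet> J (y' - y) + \<sigma> * (u \<bullet> (u' - u)))"
  using assms by (auto simp: penalty_vi_def lower_feasible_def)

lemma penalty_vi_feasible:
  assumes "penalty_vi \<beta> \<alpha> x (y, u)"
  shows "A y = B u" "u \<in> Uad"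
  using assms by (auto simp: penalty_vi_def lower_feasible_def)

text \<open>With \<open>x\<close> fixed, the tangent inequality of \<open>F\<close> and that of
  \<open>f\<close> weighted by \<open>\<alpha>\<close> add up, and the variational inequality makes
  the sum of their linear terms nonnegative.\<close>

lemma penalty_vi_minimal:
  assumes "penalty_vi 1 \<alpha> x (y, u)" "A y' = B u'" "u' \<in> Uad" "\<alpha> \<ge> 0"
  shows "F (x, y, u) + \<alpha> * f (x, y, u) \<le> F (x, y', u') + \<alpha> * f (x, y', u')"
proof -
  have "\<alpha> * f (x, y', u') \<ge> \<alpha> * (f (x, y, u) + ((J y - E x) \<bullet> J (y' - y) + \<sigma> * (u \<bullet> (u' - u))))"
    using assms(4) \<sigma>_pos f_expansion[of x y' u' x y u]
    by (intro mult_left_mono) (simp_all add: blinfun.zero_right)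
  thus ?thesis
    using F_above_tangent[of x y u x y' u'] penalty_viD[OF assms(1-3)]
    by (simp add: algebra_simps)
qed

section \<open>The lower-level solution and the optimal value function\<close>

lemma lower_solution_optimal:
  "lower_solution x \<in> lower_feasible"
  "z \<in> lower_feasible \<Longrightarrow> f (x, lower_solution x) \<le> f (x, z)"
  using theI'[OF lower_solution_unique_exists[of x]] unfolding lower_solution_def by blast+

lemma lower_feasible_convex: "convex lower_feasible"
  unfolding convex_def lower_feasible_def using Uad(3)
  by (auto simp: blinfun.add_right blinfun.scaleR_right convex_def)

text \<open>First-order optimality: on the segment towards another feasible point the objective
  changes by exactly \<open>t * d + t^2 * q\<close>, which would be negative for small
  \<open>t > 0\<close> if the slope \<open>d\<close> were negative.\<close>

lemma penalty_vi_lower_solution: "penalty_vi 0 1 x (lower_solution x)"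
proof -
  obtain y u where yu: "lower_solution x = (y, u)" by fastforce
  have feas: "(y, u) \<in> lower_feasible" using lower_solution_optimal(1)[of x] yu by simp
  have "0 \<le> (J y - E x) \<bullet> J (y' - y) + \<sigma> * (u \<bullet> (u' - u))"
    if feas': "(y', u') \<in> lower_feasible" for y' u'
  proof (rule ccontr)
    define d where "d = (J y - E x) \<bullet> J (y' - y) + \<sigma> * (u \<bullet> (u' - u))"
    define q where "q = 1/2 * (norm (J (y' - y)))\<^sup>2 + \<sigma>/2 * (norm (u' - u))\<^sup>2"
    assume "\<not> 0 \<le> (J y - E x) \<bullet> J (y' - y) + \<sigma> * (u \<bullet> (u' - u))"
    hence d: "d < 0" by (simp add: d_def)
    have q: "q \<ge> 0" using \<sigma>_pos by (simp add: q_def)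
    have main: "0 \<le> t * d + t\<^sup>2 * q" if t: "0 \<le> t" "t \<le> 1" for t
    proof -
      define y2 u2 where "y2 = y + t *\<^sub>R (y' - y)" and "u2 = u + t *\<^sub>R (u' - u)"
      have "(1 - t) *\<^sub>R (y, u) + t *\<^sub>R (y', u') \<in> lower_feasible"
        using t by (intro convexD[OF lower_feasible_convex] feas feas') auto
      moreover have "(1 - t) *\<^sub>R (y, u) + t *\<^sub>R (y', u') = (y2, u2)"
        by (simp add: y2_def u2_def algebra_simps)
      ultimately have "f (x, y, u) \<le> f (x, y2, u2)"
        using lower_solution_optimal(2)[of _ x] yu by simp
      also have "\<dots> = f (x, y, u) + t * d + t\<^sup>2 * q"
        unfolding f_expansion[of x y2 u2 x y u] d_def q_def
        by (simp add: y2_def u2_def blinfun.scaleR_right blinfun.zero_right power_mult_distrib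
            distrib_left right_diff_distrib)
      finally show ?thesis by simp
    qed
    \<comment> \<open>The bound 1 keeps the point on the segment; the other bound gives
      \<open>t * q \<le> - d / 2\<close>, so that \<open>d + t * q\<close> stays negative. The
      summand 1 in the denominator covers \<open>q = 0\<close>.\<close>
    define t where "t = min 1 (- d / (2 * (q + 1)))"
    have t: "0 < t" "t \<le> 1" using d q by (auto simp: t_def field_simps)
    have "t * q \<le> (- d / (2 * (q + 1))) * (q + 1)"
      using d q t by (intro mult_mono) (auto simp: t_def intro!: divide_nonneg_pos)
    also have "\<dots> = - d / 2" using q by (simp add: field_simps)
    finally have "t * q \<le> - d / 2" .
    moreover have "0 \<le> t * (d + t * q)"
      using main[of t] t by (simp add: power2_eq_square algebra_simps)
    ultimately show False using t d by (simp add: zero_le_mult_iff)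
  qed
  thus ?thesis unfolding yu penalty_vi_def using feas by auto
qed

lemma \<phi>_le_f:
  assumes "A y = B u" "u \<in> Uad"
  shows "\<phi> x \<le> f (x, y, u)"
  unfolding \<phi>_def using assms lower_solution_optimal(2)[of "(y, u)" x]
  by (simp add: lower_feasible_def)

text \<open>The subgradient inequality of the convex value function. Expanding \<open>f\<close> from
  the solution at \<open>x\<close> to the solution at \<open>x'\<close>, the squares are
  nonnegative, and so is the linear part in \<open>(y, u)\<close> by the variational inequality at
  \<open>x\<close>.\<close>

lemma \<phi>_above_tangent: "\<phi> x' \<ge> \<phi> x - (J (y_opt x) - E x) \<bullet> E (x' - x)"
proof -
  obtain y u where yu: "lower_solution x = (y, u)" by fastforce
  obtain y' u' where yu': "lower_solution x' = (y', u')" by fastforce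
  have "0 \<le> (J y - E x) \<bullet> J (y' - y) + \<sigma> * (u \<bullet> (u' - u))"
    using penalty_viD[of 0 1 x y u y' u'] penalty_vi_lower_solution[of x] yu
      penalty_vi_feasible[of 0 1 x' y' u'] penalty_vi_lower_solution[of x'] yu' by simp
  moreover have "0 \<le> \<sigma>/2 * (norm (u' - u))\<^sup>2" using \<sigma>_pos by simp
  moreover have "0 \<le> 1/2 * (norm (J (y' - y) - E (x' - x)))\<^sup>2" by simp
  ultimately show ?thesis
    unfolding \<phi>_def yu yu' y_opt_def fst_conv f_expansion[of x' y' u' x y u] by linarith
qed

section \<open>Lipschitz dependence of the lower-level variables on \<open>x\<close> and closedness
  of the variational inequality\<close>

lemma A_inverse:
  obtains R where "\<And>y. blinfun_apply R (blinfun_apply A y) = y" "\<And>l. blinfun_apply A (blinfun_apply R l) = l"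
proof -
  obtain R where "R o\<^sub>L A = id_blinfun" "A o\<^sub>L R = id_blinfun"
    using A_iso by (auto simp: is_isomorphism_def)
  hence "R (A y) = y" "A (R l) = l" for y l
    by (metis blinfun_apply_blinfun_compose blinfun_apply_id_blinfun id_apply)+
  thus ?thesis by (rule that)
qed

lemma state_lipschitz:
  obtains C where "C \<ge> 0"
    "\<And>y u y' u'. A y = B u \<Longrightarrow> A y' = B u' \<Longrightarrow> norm (y - y') \<le> C * norm (u - u')"
proof -
  obtain R where R: "\<And>y. blinfun_apply R (blinfun_apply A y) = y"
    by (rule A_inverse) blast
  have "norm (y - y') \<le> norm (R o\<^sub>L B) * norm (u - u')" if "A y = B u" "A y' = B u'" for y u y' u'
  proof -
    have "y - y' = (R o\<^sub>L B) (u - u')"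
      using that by (simp add: R blinfun.diff_right flip: that)
    thus ?thesis using norm_blinfun by metis
  qed
  thus ?thesis using that norm_ge_zero by blast
qed

text \<open>Each of two solutions is a test point for the inequality of the other. In the sum of the
  two inequalities, strong convexity yields \<open>\<alpha> * \<sigma> * n^2\<close> with
  \<open>n\<close> the distance of the controls, monotonicity absorbs the dependence of the
  gradients of \<open>F\<close> on \<open>(y, u)\<close>, and what remains is of order
  \<open>d * n\<close> with \<open>d\<close> the distance of the upper-level variables. The states
  follow the controls.\<close>

lemma penalty_vi_lipschitz:
  assumes Ly: "Ly-lipschitz_on UNIV (partial_y F)" and Lu: "Lu-lipschitz_on UNIV (partial_u F)"
    and "\<beta> \<ge> 0" "\<alpha> > 0"
  obtains C where "C \<ge> 0" "\<And>x z x' z'. penalty_vi \<beta> \<alpha> x z \<Longrightarrow> penalty_vi \<beta> \<alpha> x' z' \<Longrightarrow>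
      norm (z - z') \<le> C * norm (x - x')"
proof -
  obtain S where S: "S \<ge> 0"
    "\<And>y u y' u'. A y = B u \<Longrightarrow> A y' = B u' \<Longrightarrow> norm (y - y') \<le> S * norm (u - u')"
    by (rule state_lipschitz) blast
  have Ly0: "Ly \<ge> 0" and Lu0: "Lu \<ge> 0" using Ly Lu by (auto intro: lipschitz_on_nonneg)
  \<comment> \<open>\<open>K\<close> collects the coefficients of \<open>d * n\<close>: the first
    summand stems from the gradients of \<open>F\<close>, the second from the term coupling
    \<open>E x\<close> with the state.\<close>
  define K where "K = \<beta> * (Ly * S + Lu) + \<alpha> * (norm E * norm J * S)"
  have K0: "K \<ge> 0" using assms(3,4) Ly0 Lu0 S(1) by (simp add: K_def)
  have main: "norm ((y1, u1) - (y2, u2)) \<le> ((S + 1) * (K / (\<alpha> * \<sigma>))) * norm (x1 - x2)"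
    if vi1: "penalty_vi \<beta> \<alpha> x1 (y1, u1)" and vi2: "penalty_vi \<beta> \<alpha> x2 (y2, u2)" for x1 y1 u1 x2 y2 u2
  proof -
    define d n m where "d = norm (x1 - x2)" and "n = norm (u1 - u2)" and "m = norm (y1 - y2)"
    note f1 = penalty_vi_feasible[OF vi1] and f2 = penalty_vi_feasible[OF vi2]
    have m: "m \<le> S * n" unfolding m_def n_def by (rule S(2)) (use f1 f2 in auto)
    have d0: "d \<ge> 0" and n0: "n \<ge> 0" and m0: "m \<ge> 0" by (auto simp: d_def n_def m_def)
    define D where "D = (partial_y F (x2, y2, u2) - partial_y F (x1, y1, u1)) (y1 - y2)
        + (partial_u F (x2, y2, u2) - partial_u F (x1, y1, u1)) \<bullet> (u1 - u2)"
    define D' where "D' = (partial_y F (x2, y2, u2) - partial_y F (x1, y2, u2)) (y1 - y2)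
        + (partial_u F (x2, y2, u2) - partial_u F (x1, y2, u2)) \<bullet> (u1 - u2)"
    have sum: "0 \<le> \<beta> * D + \<alpha> * ((E x1 - E x2) \<bullet> J (y1 - y2) - (norm (J (y1 - y2)))\<^sup>2 - \<sigma> * n\<^sup>2)"
      using add_mono[OF penalty_viD[OF vi1 f2] penalty_viD[OF vi2 f1]]
      unfolding D_def n_def power2_norm_eq_inner
      by (simp add: blinfun.diff_right blinfun.diff_left inner_simps inner_commute algebra_simps)
    \<comment> \<open>Monotonicity of the gradient of the convex function
      \<open>F (x1, \<cdot>)\<close>, from two opposite tangent inequalities. In \<open>D'\<close>
      the gradients differ only in their \<open>x\<close>-argument, so that the Lipschitz constants
      produce the factor \<open>d\<close>.\<close>
    have "D \<le> D'"
      using F_above_tangent[of x1 y1 u1 x1 y2 u2] F_above_tangent[of x1 y2 u2 x1 y1 u1]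
      unfolding D_def D'_def by (simp add: blinfun.diff_right blinfun.diff_left inner_simps algebra_simps)
    also have "D' \<le> (Ly * d) * m + (Lu * d) * n"
      unfolding D'_def
    proof (rule add_mono)
      have "norm (partial_y F (x2, y2, u2) - partial_y F (x1, y2, u2)) \<le> Ly * norm ((x2, y2, u2) - (x1, y2, u2))"
        by (rule lipschitz_on_normD[OF Ly]) auto
      hence *: "norm (partial_y F (x2, y2, u2) - partial_y F (x1, y2, u2)) \<le> Ly * d"
        by (simp add: norm_Pair d_def norm_minus_commute)
      have "(partial_y F (x2, y2, u2) - partial_y F (x1, y2, u2)) (y1 - y2)
          \<le> norm (partial_y F (x2, y2, u2) - partial_y F (x1, y2, u2)) * norm (y1 - y2)"
        using norm_blinfun[of "partial_y F (x2, y2, u2) - partial_y F (x1, y2, u2)" "y1 - y2"] by simp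
      also have "\<dots> \<le> (Ly * d) * m" unfolding m_def by (rule mult_right_mono[OF *]) simp
      finally show "(partial_y F (x2, y2, u2) - partial_y F (x1, y2, u2)) (y1 - y2) \<le> (Ly * d) * m" .
    next
      have "norm (partial_u F (x2, y2, u2) - partial_u F (x1, y2, u2)) \<le> Lu * norm ((x2, y2, u2) - (x1, y2, u2))"
        by (rule lipschitz_on_normD[OF Lu]) auto
      hence *: "norm (partial_u F (x2, y2, u2) - partial_u F (x1, y2, u2)) \<le> Lu * d"
        by (simp add: norm_Pair d_def norm_minus_commute)
      have "(partial_u F (x2, y2, u2) - partial_u F (x1, y2, u2)) \<bullet> (u1 - u2)
          \<le> norm (partial_u F (x2, y2, u2) - partial_u F (x1, y2, u2)) * norm (u1 - u2)"
        by (rule norm_cauchy_schwarz)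
      also have "\<dots> \<le> (Lu * d) * n" unfolding n_def by (rule mult_right_mono[OF *]) simp
      finally show "(partial_u F (x2, y2, u2) - partial_u F (x1, y2, u2)) \<bullet> (u1 - u2) \<le> (Lu * d) * n" .
    qed
    also have "\<dots> \<le> (Ly * d) * (S * n) + (Lu * d) * n"
      using m Ly0 d0 by (intro add_right_mono mult_left_mono) auto
    finally have D: "D \<le> (Ly * S + Lu) * d * n" by (simp add: algebra_simps)
    have "(E x1 - E x2) \<bullet> J (y1 - y2) \<le> norm (E x1 - E x2) * norm (J (y1 - y2))"
      by (rule norm_cauchy_schwarz)
    also have "\<dots> \<le> (norm E * d) * (norm J * m)"
      unfolding d_def m_def blinfun.diff_right[symmetric] by (intro mult_mono norm_blinfun) auto
    also have "\<dots> \<le> (norm E * d) * (norm J * (S * n))"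
      using m d0 by (intro mult_left_mono) auto
    finally have "(E x1 - E x2) \<bullet> J (y1 - y2) \<le> norm E * norm J * S * d * n"
      by (simp only: mult.assoc mult.commute mult.left_commute)
    hence "(E x1 - E x2) \<bullet> J (y1 - y2) - (norm (J (y1 - y2)))\<^sup>2 - \<sigma> * n\<^sup>2
        \<le> norm E * norm J * S * d * n - \<sigma> * n\<^sup>2"
      using zero_le_power2[of "norm (J (y1 - y2))"] by linarith
    hence "\<alpha> * ((E x1 - E x2) \<bullet> J (y1 - y2) - (norm (J (y1 - y2)))\<^sup>2 - \<sigma> * n\<^sup>2)
        \<le> \<alpha> * (norm E * norm J * S * d * n - \<sigma> * n\<^sup>2)"
      using assms(4) by (intro mult_left_mono) auto
    with sum mult_left_mono[OF D assms(3)]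
    have "\<alpha> * \<sigma> * n\<^sup>2 \<le> K * d * n" unfolding K_def by (simp add: algebra_simps)
    hence "(\<alpha> * \<sigma> * n - K * d) * n \<le> 0" by (simp add: power2_eq_square algebra_simps)
    hence "\<alpha> * \<sigma> * n \<le> K * d"
      using n0 K0 d0 by (cases "n = 0") (auto simp: mult_le_0_iff)
    hence n: "n \<le> K / (\<alpha> * \<sigma>) * d" using assms(4) \<sigma>_pos by (simp add: field_simps)
    have "norm ((y1, u1) - (y2, u2)) \<le> m + n"
      unfolding diff_Pair m_def n_def by (rule norm_Pair_le)
    also have "\<dots> \<le> (S + 1) * n" using m by (simp add: algebra_simps)
    also have "\<dots> \<le> (S + 1) * (K / (\<alpha> * \<sigma>) * d)" using n S(1) by (intro mult_left_mono) auto
    finally show ?thesis by (simp add: d_def)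
  qed
  have "(S + 1) * (K / (\<alpha> * \<sigma>)) \<ge> 0" using S(1) K0 assms(4) \<sigma>_pos by simp
  thus ?thesis by (rule that) (use main in auto)
qed

lemma penalty_vi_limit:
  assumes Ly: "Ly-lipschitz_on UNIV (partial_y F)" and Lu: "Lu-lipschitz_on UNIV (partial_u F)"
    and vi: "\<And>j. penalty_vi \<beta> \<alpha> (xs j) (ys j, us j)"
    and lim: "xs \<longlonglongrightarrow> x" "ys \<longlonglongrightarrow> y" "us \<longlonglongrightarrow> u"
  shows "penalty_vi \<beta> \<alpha> x (y, u)"
proof -
  have p: "(\<lambda>j. (xs j, ys j, us j)) \<longlonglongrightarrow> (x, y, u)" by (intro tendsto_Pair lim)
  have ly: "(\<lambda>j. partial_y F (xs j, ys j, us j)) \<longlonglongrightarrow> partial_y F (x, y, u)"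
    by (rule continuous_on_tendsto_compose[OF lipschitz_on_continuous_on[OF Ly] p]) auto
  have lu: "(\<lambda>j. partial_u F (xs j, ys j, us j)) \<longlonglongrightarrow> partial_u F (x, y, u)"
    by (rule continuous_on_tendsto_compose[OF lipschitz_on_continuous_on[OF Lu] p]) auto
  have "u \<in> Uad"
    by (rule closed_sequentially[OF Uad(2) _ lim(3)]) (use penalty_vi_feasible[OF vi] in blast)
  moreover have "A y = B u"
  proof (rule LIMSEQ_unique)
    show "(\<lambda>j. B (us j)) \<longlonglongrightarrow> B u" by (intro tendsto_intros lim)
    show "(\<lambda>j. B (us j)) \<longlonglongrightarrow> A y"
      using penalty_vi_feasible(1)[OF vi] by (subst penalty_vi_feasible(1)[OF vi, symmetric]) (intro tendsto_intros lim)
  qed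
  moreover have "0 \<le> \<beta> * (partial_y F (x, y, u) (y' - y) + partial_u F (x, y, u) \<bullet> (u' - u))
             + \<alpha> * ((J y - E x) \<bullet> J (y' - y) + \<sigma> * (u \<bullet> (u' - u)))"
    if "A y' = B u'" "u' \<in> Uad" for y' u'
  proof (rule LIMSEQ_le_const)
    show "(\<lambda>j. \<beta> * (partial_y F (xs j, ys j, us j) (y' - ys j) + partial_u F (xs j, ys j, us j) \<bullet> (u' - us j))
             + \<alpha> * ((J (ys j) - E (xs j)) \<bullet> J (y' - ys j) + \<sigma> * (us j \<bullet> (u' - us j))))
        \<longlonglongrightarrow> \<beta> * (partial_y F (x, y, u) (y' - y) + partial_u F (x, y, u) \<bullet> (u' - u))
             + \<alpha> * ((J y - E x) \<bullet> J (y' - y) + \<sigma> * (u \<bullet> (u' - u)))"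
      by (intro tendsto_intros lim ly lu)
  qed (use penalty_viD[OF vi that] in blast)
  ultimately show ?thesis by (auto simp: penalty_vi_def lower_feasible_def)
qed

section \<open>Multipliers and the variational inequality\<close>

text \<open>The adjoint of an isomorphism is onto. Identifying the space with its dual by Riesz, the
  functional \<open>l\<close> composed with the inverse \<open>R\<close> of \<open>A\<close> is
  represented by some \<open>p\<close>, and pairing \<open>A h\<close> with \<open>p\<close> gives
  \<open>l (R (A h)) = l h\<close>.\<close>

lemma A_adj_surj: "\<exists>p. A_adj p = l"
proof -
  obtain R where R: "\<And>y. blinfun_apply R (blinfun_apply A y) = y" "\<And>l. blinfun_apply A (blinfun_apply R l) = l"
    by (rule A_inverse) blast
  have "bounded_linear (\<lambda>w. l (R (blinfun_inner_right w)))"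
    by (intro bounded_linear_intros)
  then obtain p where p: "\<And>w. p \<bullet> w = l (R (blinfun_inner_right w))"
    using riesz_representation by blast
  have "A_adj p h = l h" for h
  proof -
    obtain w where w: "\<And>k. w \<bullet> k = A h k"
      using riesz_representation[OF blinfun.bounded_linear_right[of "A h"]] by blast
    hence "blinfun_inner_right w = A h" by (intro blinfun_eqI) simp
    thus ?thesis using p[of w] w[of p] R(1)[of h] by (simp add: A_adj_apply inner_commute)
  qed
  thus ?thesis by (intro exI blinfun_eqI)
qed

text \<open>Forwards, the adjoint equation is solved for \<open>lp\<close>, the second equation then
  defines \<open>lu\<close>, and the variational inequality at the state belonging to a control
  \<open>c\<close> is the normal cone condition. Backwards, the two equations are tested with the
  differences of states and controls and added.\<close>

lemma penalty_vi_iff_multipliers: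
  "penalty_vi 1 \<alpha> x (y, u) \<longleftrightarrow> 0 = A y - B u \<and> (\<exists>lp lu. lu \<in> normal_cone Uad u \<and>
     0 = partial_y F (x, y, u) + A_adj lp + \<alpha> *\<^sub>R partial_y f (x, y, u) \<and>
     0 = partial_u F (x, y, u) - B_adj lp + lu + \<alpha> *\<^sub>R partial_u f (x, y, u))"
  (is "_ \<longleftrightarrow> _ \<and> (\<exists>lp lu. ?multipliers lp lu)")
proof
  assume vi: "penalty_vi 1 \<alpha> x (y, u)"
  note feas = penalty_vi_feasible[OF vi]
  obtain lp where lp: "A_adj lp = - (partial_y F (x, y, u) + \<alpha> *\<^sub>R partial_y f (x, y, u))"
    using A_adj_surj by blast
  define lu where "lu = - (partial_u F (x, y, u) - B_adj lp + \<alpha> *\<^sub>R partial_u f (x, y, u))"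
  have "lu \<bullet> (c - u) \<le> 0" if c: "c \<in> Uad" for c
  proof -
    obtain y' where y': "A y' = B c" using bij_A by (metis bij_pointE)
    \<comment> \<open>Both points satisfy the state equation, so
      \<open>B (c - u) = A (y' - y)\<close>; this lets the two terms with \<open>lp\<close>
      cancel.\<close>
    have "B_adj lp \<bullet> (c - u) = A_adj lp (y' - y)"
      by (simp add: B_adj_inner A_adj_apply blinfun.diff_right blinfun.diff_left y' feas(1))
    hence "lu \<bullet> (c - u) = - (partial_u F (x, y, u) \<bullet> (c - u)) + A_adj lp (y' - y) - \<alpha> * \<sigma> * (u \<bullet> (c - u))"
      by (simp add: lu_def partial_u_f inner_simps algebra_simps)
    also have "A_adj lp (y' - y) = - partial_y F (x, y, u) (y' - y) - \<alpha> * ((J y - E x) \<bullet> J (y' - y))"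
      by (simp add: lp partial_y_f blinfun.minus_left blinfun.add_left blinfun.diff_left blinfun.scaleR_left)
    finally show ?thesis using penalty_viD[OF vi y' c] by (simp add: algebra_simps)
  qed
  hence "lu \<in> normal_cone Uad u" using feas by (simp add: normal_cone_def)
  moreover have "0 = partial_y F (x, y, u) + A_adj lp + \<alpha> *\<^sub>R partial_y f (x, y, u)" by (simp add: lp)
  moreover have "0 = partial_u F (x, y, u) - B_adj lp + lu + \<alpha> *\<^sub>R partial_u f (x, y, u)"
    by (simp add: lu_def)
  ultimately show "0 = A y - B u \<and> (\<exists>lp lu. ?multipliers lp lu)" using feas by auto
next
  assume "0 = A y - B u \<and> (\<exists>lp lu. ?multipliers lp lu)"
  then obtain lp lu where feas: "A y = B u" and m: "?multipliers lp lu" by auto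
  have u: "u \<in> Uad" using m by (auto simp: normal_cone_def split: if_splits)
  have "0 \<le> 1 * (partial_y F (x, y, u) (y' - y) + partial_u F (x, y, u) \<bullet> (u' - u))
             + \<alpha> * ((J y - E x) \<bullet> J (y' - y) + \<sigma> * (u \<bullet> (u' - u)))"
    if y': "A y' = B u'" and u': "u' \<in> Uad" for y' u'
  proof -
    have "0 = (partial_y F (x, y, u) + A_adj lp + \<alpha> *\<^sub>R partial_y f (x, y, u)) (y' - y)"
      using m by (metis blinfun.zero_left)
    hence "0 = partial_y F (x, y, u) (y' - y) + A_adj lp (y' - y) + \<alpha> * ((J y - E x) \<bullet> J (y' - y))"
      by (simp add: partial_y_f blinfun.add_left blinfun.scaleR_left)
    moreover have "0 = (partial_u F (x, y, u) - B_adj lp + lu + \<alpha> *\<^sub>R partial_u f (x, y, u)) \<bullet> (u' - u)"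
      using m by (metis inner_zero_left)
    hence "0 = partial_u F (x, y, u) \<bullet> (u' - u) - B_adj lp \<bullet> (u' - u) + lu \<bullet> (u' - u) + \<alpha> * \<sigma> * (u \<bullet> (u' - u))"
      by (simp add: partial_u_f inner_add_left inner_diff_left)
    moreover have "B_adj lp \<bullet> (u' - u) = A_adj lp (y' - y)"
      by (simp add: B_adj_inner A_adj_apply blinfun.diff_right blinfun.diff_left y' feas)
    moreover have "lu \<bullet> (u' - u) \<le> 0" using m u' u by (simp add: normal_cone_def)
    ultimately show ?thesis by (simp add: algebra_simps)
  qed
  thus "penalty_vi 1 \<alpha> x (y, u)" using feas u by (auto simp: penalty_vi_def lower_feasible_def)
qed

subsection \<open>The penalty algorithm\<close>

lemma F_lower_bound:
  assumes "bdd_below (F ` (Xad \<times> (control_to_state ` Uad) \<times> Uad))"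
  obtains m where "\<And>x y u. x \<in> Xad \<Longrightarrow> A y = B u \<Longrightarrow> u \<in> Uad \<Longrightarrow> m \<le> F (x, y, u)"
proof -
  obtain m where m: "\<And>p. p \<in> Xad \<times> (control_to_state ` Uad) \<times> Uad \<Longrightarrow> m \<le> F p"
    using assms unfolding bdd_below_def by blast
  show ?thesis
    by (rule that[of m], rule m) (auto simp flip: control_to_state_iff)
qed

lemma lower_solution_lipschitz:
  assumes "Ly-lipschitz_on UNIV (partial_y F)" "Lu-lipschitz_on UNIV (partial_u F)"
  obtains C where "C-lipschitz_on UNIV lower_solution"
proof -
  obtain C where "C \<ge> 0" "\<And>x z x' z'. penalty_vi 0 1 x z \<Longrightarrow> penalty_vi 0 1 x' z' \<Longrightarrow>
      norm (z - z') \<le> C * norm (x - x')"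
    by (rule penalty_vi_lipschitz[OF assms order_refl zero_less_one]) blast
  hence "C-lipschitz_on UNIV lower_solution"
    using penalty_vi_lower_solution by (intro lipschitz_onI) (auto simp: dist_norm)
  thus ?thesis by (rule that)
qed

text \<open>Comparing an iterate with the lower-level solution gives
  \<open>\<alpha> (f - \<phi>) \<le> sup F - inf F\<close>, while \<open>f - \<phi> > \<epsilon>\<close> as long as the algorithm runs.\<close>

lemma penalty_parameter_bounded:
  assumes "Ly-lipschitz_on UNIV (partial_y F)" "Lu-lipschitz_on UNIV (partial_u F)"
    and "bdd_below (F ` (Xad \<times> (control_to_state ` Uad) \<times> Uad))"
  obtains M where "\<And>\<alpha> x y u. x \<in> Xad \<Longrightarrow> \<alpha> \<ge> 0 \<Longrightarrow> penalty_vi 1 \<alpha> x (y, u) \<Longrightarrow> V (x, y, u) > 0 \<Longrightarrow> \<alpha> \<le> M"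
proof -
  obtain C where "C-lipschitz_on UNIV lower_solution" by (rule lower_solution_lipschitz[OF assms(1,2)])
  \<comment> \<open>The upper bound \<open>U\<close> for \<open>F\<close> along the lower-level
    solutions comes from continuity on the compact set \<open>Xad\<close>.\<close>
  hence "continuous_on Xad lower_solution"
    by (rule continuous_on_subset[OF lipschitz_on_continuous_on]) simp
  hence "continuous_on Xad (\<lambda>x. F (x, lower_solution x))"
    by (intro continuous_on_compose2[OF F_continuous[of UNIV]] continuous_intros) auto
  hence "compact ((\<lambda>x. F (x, lower_solution x)) ` Xad)" by (rule compact_continuous_image) (rule Xad)
  hence "bdd_above ((\<lambda>x. F (x, lower_solution x)) ` Xad)"
    by (intro bounded_imp_bdd_above compact_imp_bounded)
  then obtain U where "\<And>v. v \<in> (\<lambda>x. F (x, lower_solution x)) ` Xad \<Longrightarrow> v \<le> U"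
    by (rule bdd_above.E) (rule that)
  hence U: "\<And>x. x \<in> Xad \<Longrightarrow> F (x, lower_solution x) \<le> U" by simp
  obtain m where m: "\<And>x y u. x \<in> Xad \<Longrightarrow> A y = B u \<Longrightarrow> u \<in> Uad \<Longrightarrow> m \<le> F (x, y, u)"
    by (rule F_lower_bound[OF assms(3)]) blast
  have "\<alpha> \<le> (U - m) / \<epsilon>"
    if x: "x \<in> Xad" and \<alpha>: "\<alpha> \<ge> 0" and vi: "penalty_vi 1 \<alpha> x (y, u)" and V: "V (x, y, u) > 0" for \<alpha> x y u
  proof -
    obtain y' u' where yu: "lower_solution x = (y', u')" by fastforce
    hence "penalty_vi 0 1 x (y', u')" using penalty_vi_lower_solution[of x] by simp
    from penalty_vi_minimal[OF vi penalty_vi_feasible[OF this] \<alpha>]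
    have "\<alpha> * (f (x, y, u) - \<phi> x) \<le> F (x, lower_solution x) - F (x, y, u)"
      by (simp add: \<phi>_def yu algebra_simps)
    also have "\<dots> \<le> U - m" using U[OF x] m[OF x penalty_vi_feasible[OF vi]] by simp
    finally have "\<alpha> * (f (x, y, u) - \<phi> x) \<le> U - m" .
    moreover have "\<alpha> * \<epsilon> \<le> \<alpha> * (f (x, y, u) - \<phi> x)"
      using V \<alpha> by (intro mult_left_mono) (auto simp: V_def)
    ultimately show ?thesis using \<epsilon>_pos by (simp add: field_simps)
  qed
  thus ?thesis by (rule that)
qed

section \<open>Descent of the merit function\<close>

text \<open>The derivative in \<open>x\<close> of \<open>F + a * (f - \<phi>)\<close> with
  \<open>(y, u)\<close> held fixed; it is the direction \<open>w k\<close> of the algorithm once the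
  penalty parameter used there equals \<open>a\<close>.\<close>

definition reduced_gradient :: "real \<Rightarrow> (real^'n) \<times> 'y \<times> 'u \<Rightarrow> real^'n" where
  "reduced_gradient a = (\<lambda>(x, y, u). partial_x F (x, y, u)
      + a *\<^sub>R (partial_x f (x, y, u) - E_adj (E x - J (y_opt x))))"

lemma reduced_gradient_inner:
  "reduced_gradient a (x, y, u) \<bullet> h = partial_x F (x, y, u) \<bullet> h + a * ((J (y_opt x) - J y) \<bullet> E h)"
  by (simp add: reduced_gradient_def partial_x_f inner_add_left inner_diff_left E_adj_inner)

text \<open>Since \<open>\<phi>\<close> is convex, subtracting it does not spoil the quadratic upper bound on the merit
  function, and no differentiability of the merit function is needed.\<close>

lemma merit_descent:
  assumes "L-lipschitz_on UNIV (partial_x F)" "a \<ge> 0" "penalty_vi 1 a x (y, u)" "penalty_vi 1 a x' (y', u')"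
  shows "F (x', y', u') + a * (f (x', y', u') - \<phi> x') \<le> F (x, y, u) + a * (f (x, y, u) - \<phi> x)
      + reduced_gradient a (x, y, u) \<bullet> (x' - x) + (L + a * (norm E)\<^sup>2) * (norm (x' - x))\<^sup>2"
proof -
  note [simp] = blinfun.zero_right
  have "(norm (E (x' - x)))\<^sup>2 \<le> (norm E * norm (x' - x))\<^sup>2"
    by (intro power_mono norm_blinfun) simp
  moreover have "f (x', y, u) = f (x, y, u) - (J y - E x) \<bullet> E (x' - x) + 1/2 * (norm (E (x' - x)))\<^sup>2"
    using f_expansion[of x' y u x y u] by simp
  ultimately have "f (x', y, u) \<le> f (x, y, u) - (J y - E x) \<bullet> E (x' - x) + (norm E * norm (x' - x))\<^sup>2"
    using zero_le_power2[of "norm (E (x' - x))"] by linarith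
  hence "f (x', y, u) - \<phi> x' \<le> f (x, y, u) - \<phi> x + (J (y_opt x) - J y) \<bullet> E (x' - x) + (norm E * norm (x' - x))\<^sup>2"
    using \<phi>_above_tangent[of x x'] by (simp add: inner_diff_left)
  from mult_left_mono[OF this assms(2)]
  have "a * (f (x', y, u) - \<phi> x') \<le> a * (f (x, y, u) - \<phi> x) + a * ((J (y_opt x) - J y) \<bullet> E (x' - x))
      + a * (norm E)\<^sup>2 * (norm (x' - x))\<^sup>2"
    by (simp add: algebra_simps power_mult_distrib)
  \<comment> \<open>At \<open>x'\<close> the pair \<open>(y', u')\<close> does at least as well as
    the old pair \<open>(y, u)\<close>, so only the change of \<open>x\<close> with
    \<open>(y, u)\<close> frozen has to be estimated.\<close>
  thus ?thesis
    using penalty_vi_minimal[OF assms(4) penalty_vi_feasible[OF assms(3)] assms(2)]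
      F_x_upper_bound[OF assms(1), of x' y u x]
    unfolding reduced_gradient_inner by (simp add: algebra_simps)
qed

section \<open>Eventual behaviour of an infinite run\<close>

text \<open>Collects what the limit arguments use about a run, from an index \<open>K\<close> on at
  which the penalty parameter has settled at a value \<open>a\<close>. The projection step is
  recorded by its variational characterization.\<close>

lemma penalty_sequence_tail:
  assumes "penalty_sequence x0 \<alpha>0 \<gamma> \<eta> \<kappa> z" "x0 \<in> Xad" "\<alpha>0 > 0" "\<gamma> > 1" "0 < \<kappa>" "\<kappa> < 1"
    and M: "\<And>\<alpha> x y u. x \<in> Xad \<Longrightarrow> \<alpha> \<ge> 0 \<Longrightarrow> penalty_vi 1 \<alpha> x (y, u) \<Longrightarrow> V (x, y, u) > 0 \<Longrightarrow> \<alpha> \<le> M"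
  obtains x y u a K where "0 < a" "a \<le> M" "z = (\<lambda>k. (x k, y k, u k))" "\<And>k. x k \<in> Xad"
    "\<And>k. k \<ge> K \<Longrightarrow> penalty_vi 1 a (x k) (y k, u k)" "(\<lambda>k. V (z k)) \<longlonglongrightarrow> 0"
    "\<And>k c. k \<ge> K \<Longrightarrow> c \<in> Xad \<Longrightarrow> (x k - \<eta> *\<^sub>R reduced_gradient a (z k) - x (Suc k)) \<bullet> (c - x (Suc k)) \<le> 0"
proof -
  obtain x y u \<alpha> lp lu w where z: "\<forall>k. z k = (x k, y k, u k)" and init: "x 0 = x0" "\<alpha> 0 = \<alpha>0"
    and run: "\<forall>k. 0 = partial_y F (z k) + A_adj (lp k) + \<alpha> k *\<^sub>R partial_y f (z k) \<and>
             0 = partial_u F (z k) - B_adj (lp k) + lu k + \<alpha> k *\<^sub>R partial_u f (z k) \<and>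
             0 = A (y k) - B (u k) \<and>
             lu k \<in> normal_cone Uad (u k) \<and>
             \<not> V (z k) \<le> 0 \<and>
             \<alpha> (Suc k) = (if ereal (V (z k)) > ereal \<kappa> * V_prev z k then \<gamma> * \<alpha> k else \<alpha> k) \<and>
             w k = partial_x F (z k)
                     + \<alpha> (Suc k) *\<^sub>R (partial_x f (z k) - E_adj (E (x k) - J (y_opt (x k)))) \<and>
             x (Suc k) = closest_point Xad (x k - \<eta> *\<^sub>R w k)"
    using assms(1) unfolding penalty_sequence_def by (elim exE conjE) (rule that)
  note z = spec[OF z]
  have step: "0 = partial_y F (z k) + A_adj (lp k) + \<alpha> k *\<^sub>R partial_y f (z k)"
      "0 = partial_u F (z k) - B_adj (lp k) + lu k + \<alpha> k *\<^sub>R partial_u f (z k)"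
      "0 = A (y k) - B (u k)" "lu k \<in> normal_cone Uad (u k)"
    and V: "\<not> V (z k) \<le> 0"
    and \<alpha>: "\<alpha> (Suc k) = (if ereal (V (z k)) > ereal \<kappa> * V_prev z k then \<gamma> * \<alpha> k else \<alpha> k)"
    and w: "w k = partial_x F (z k)
                     + \<alpha> (Suc k) *\<^sub>R (partial_x f (z k) - E_adj (E (x k) - J (y_opt (x k))))"
    and x: "x (Suc k) = closest_point Xad (x k - \<eta> *\<^sub>R w k)" for k
    using spec[OF run, of k] by (simp_all only: simp_thms)
  have cl: "closed Xad" using Xad by (simp add: compact_imp_closed)
  have xX: "x k \<in> Xad" for k
    using init assms(2) x closest_point_in_set[OF cl Xad(1)] by (cases k) auto
  have vi: "penalty_vi 1 (\<alpha> k) (x k) (y k, u k)" for k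
    using step[of k] unfolding penalty_vi_iff_multipliers z by blast
  have \<alpha>step: "\<alpha> (Suc k) = \<alpha> k \<or> \<alpha> (Suc k) = \<gamma> * \<alpha> k" for k
    unfolding \<alpha>[of k] by (rule if_split[THEN iffD2]) blast
  have \<alpha>pos: "\<alpha> k > 0" for k
  proof (induction k)
    case (Suc k)
    thus ?case using \<alpha>step[of k] assms(4) by auto
  qed (use init assms in simp)
  have \<alpha>M: "\<alpha> k \<le> M" for k
    using M[OF xX _ vi] \<alpha>pos V[of k] unfolding z by (simp add: less_imp_le)
  obtain K where K: "\<And>k. k \<ge> K \<Longrightarrow> \<alpha> k = \<alpha> K"
    by (rule geometric_steps_eventually_constant[where \<alpha> = \<alpha>, OF \<alpha>pos assms(4) \<alpha>step \<alpha>M]) (rule that)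
  \<comment> \<open>The test at step \<open>Suc k\<close> compares with \<open>V (z k)\<close>; if
    it failed, the parameter would grow by the factor \<open>\<gamma>\<close> from
    \<open>Suc k\<close> to \<open>Suc (Suc k)\<close>, although it is constant from
    \<open>K\<close> on.\<close>
  have contr: "V (z (Suc k)) \<le> \<kappa> * V (z k)" if "k \<ge> K" for k
  proof (rule ccontr)
    assume "\<not> ?thesis"
    hence "\<alpha> (Suc (Suc k)) = \<gamma> * \<alpha> (Suc k)" using \<alpha>[of "Suc k"] by (simp add: V_prev_def)
    moreover have "\<alpha> (Suc (Suc k)) = \<alpha> (Suc k)" using K[of "Suc (Suc k)"] K[of "Suc k"] that by simp
    ultimately show False using \<alpha>pos[of "Suc k"] assms(4) by simp
  qed
  have "V (z (j + K)) \<le> \<kappa> ^ j * V (z K)" for j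
  proof (induction j)
    case (Suc j)
    have "V (z (Suc j + K)) \<le> \<kappa> * V (z (j + K))" using contr[of "j + K"] by simp
    also have "\<dots> \<le> \<kappa> * (\<kappa> ^ j * V (z K))" using Suc assms(5) by (intro mult_left_mono) auto
    finally show ?case by simp
  qed simp
  moreover have "(\<lambda>j. \<kappa> ^ j * V (z K)) \<longlonglongrightarrow> 0"
    by (rule tendsto_mult_left_zero[OF LIMSEQ_power_zero]) (use assms(5,6) in simp)
  \<comment> \<open>The lower bound 0 of the squeeze holds because the algorithm never stops, so
    every \<open>V (z k)\<close> is positive.\<close>
  ultimately have "(\<lambda>j. V (z (j + K))) \<longlonglongrightarrow> 0"
    using V by (intro tendsto_sandwich[where f = "\<lambda>_. 0" and h = "\<lambda>j. \<kappa> ^ j * V (z K)"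
          and g = "\<lambda>j. V (z (j + K))"] always_eventually allI tendsto_const)
      (simp_all add: not_le less_imp_le)
  hence V0: "(\<lambda>k. V (z k)) \<longlonglongrightarrow> 0" by (rule LIMSEQ_offset)
  \<comment> \<open>Step (1) uses \<open>\<alpha> k\<close> but step (4) uses
    \<open>\<alpha> (Suc k)\<close>; for \<open>k \<ge> K\<close> both equal
    \<open>\<alpha> K\<close>.\<close>
  have proj: "(x k - \<eta> *\<^sub>R reduced_gradient (\<alpha> K) (z k) - x (Suc k)) \<bullet> (c - x (Suc k)) \<le> 0"
    if "k \<ge> K" "c \<in> Xad" for k c
  proof -
    have "w k = reduced_gradient (\<alpha> K) (z k)"
      using w[of k] K[of "Suc k"] that by (simp add: z reduced_gradient_def)
    thus ?thesis unfolding x using closest_point_dot[OF Xad(2) cl that(2)] by simp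
  qed
  show ?thesis
  proof (rule that[of "\<alpha> K" x y u K])
    show "z = (\<lambda>k. (x k, y k, u k))" by (rule ext) (rule z)
    show "penalty_vi 1 (\<alpha> K) (x k) (y k, u k)" if "k \<ge> K" for k using vi[of k] K[OF that] by simp
  qed (fact \<alpha>pos \<alpha>M xX V0 proj)+
qed

text \<open>The projection makes the linear term of the descent estimate at most
  \<open>- 1/\<eta>\<close> times the squared step, which outweighs the quadratic term for small
  \<open>\<eta>\<close>. The merit function therefore decreases by a multiple of the squared step;
  being bounded below, it converges, and the steps vanish.\<close>

lemma projected_gradient_steps_vanish:
  assumes "L-lipschitz_on UNIV (partial_x F)" "0 < a" and \<eta>: "0 < \<eta>" "\<eta> * (L + a * (norm E)\<^sup>2) < 1"
    and "bdd_below (F ` (Xad \<times> (control_to_state ` Uad) \<times> Uad))"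
    and x: "\<And>k. x k \<in> Xad" and vi: "\<And>k. penalty_vi 1 a (x k) (y k, u k)"
    and proj: "\<And>k c. c \<in> Xad \<Longrightarrow>
      (x k - \<eta> *\<^sub>R reduced_gradient a (x k, y k, u k) - x (Suc k)) \<bullet> (c - x (Suc k)) \<le> 0"
  shows "(\<lambda>k. x (Suc k) - x k) \<longlonglongrightarrow> 0"
proof -
  obtain m where m: "\<And>x y u. x \<in> Xad \<Longrightarrow> A y = B u \<Longrightarrow> u \<in> Uad \<Longrightarrow> m \<le> F (x, y, u)"
    by (rule F_lower_bound[OF assms(5)]) blast
  define \<Phi> where "\<Phi> k = F (x k, y k, u k) + a * (f (x k, y k, u k) - \<phi> (x k))" for k
  \<comment> \<open>The net decrease per squared step; the step size condition says that it is
    positive.\<close>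
  define c where "c = 1 / \<eta> - (L + a * (norm E)\<^sup>2)"
  have c: "c > 0" using \<eta> by (simp add: c_def field_simps)
  have \<Phi>_ge: "\<Phi> k \<ge> m" for k
  proof -
    have "a * (f (x k, y k, u k) - \<phi> (x k)) \<ge> 0"
      using assms(2) \<phi>_le_f[OF penalty_vi_feasible[OF vi[of k]]] by simp
    thus ?thesis unfolding \<Phi>_def using m[OF x penalty_vi_feasible[OF vi], of k k] by linarith
  qed
  have dec: "c * (norm (x (Suc k) - x k))\<^sup>2 \<le> \<Phi> k - \<Phi> (Suc k)" for k
  proof -
    define g where "g = reduced_gradient a (x k, y k, u k) \<bullet> (x (Suc k) - x k)"
    \<comment> \<open>The projection inequality tested with the previous iterate
      \<open>x k\<close>.\<close>
    have "(norm (x (Suc k) - x k))\<^sup>2 + \<eta> * g \<le> 0"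
      using proj[OF x, of k k] unfolding power2_norm_eq_inner g_def by (simp add: inner_simps inner_commute algebra_simps)
    hence "(1 / \<eta>) * (norm (x (Suc k) - x k))\<^sup>2 \<le> - g" using \<eta> by (simp add: field_simps)
    moreover have "\<Phi> (Suc k) \<le> \<Phi> k + g + (L + a * (norm E)\<^sup>2) * (norm (x (Suc k) - x k))\<^sup>2"
      unfolding \<Phi>_def g_def using assms(2) by (intro merit_descent[OF assms(1) _ vi vi]) simp
    ultimately show ?thesis unfolding c_def left_diff_distrib by linarith
  qed
  have "\<Phi> (Suc k) \<le> \<Phi> k" for k
  proof -
    have "0 \<le> c * (norm (x (Suc k) - x k))\<^sup>2" using c by simp
    thus ?thesis using dec[of k] by linarith
  qed
  hence "decseq \<Phi>" by (rule decseq_SucI)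
  from decseq_convergent[OF this] obtain l where l: "\<Phi> \<longlonglongrightarrow> l" using \<Phi>_ge by blast
  have "(\<lambda>k. (\<Phi> k - \<Phi> (Suc k)) / c) \<longlonglongrightarrow> (l - l) / c"
    using c by (intro tendsto_divide[OF tendsto_diff[OF l LIMSEQ_Suc[OF l]] tendsto_const]) simp
  hence *: "(\<lambda>k. (\<Phi> k - \<Phi> (Suc k)) / c) \<longlonglongrightarrow> 0" by simp
  have "(\<lambda>k. (norm (x (Suc k) - x k))\<^sup>2) \<longlonglongrightarrow> 0"
    by (rule tendsto_sandwich[OF _ _ tendsto_const *])
       (use dec c in \<open>auto intro!: always_eventually simp: field_simps\<close>)
  hence "(\<lambda>k. norm (x (Suc k) - x k)) \<longlonglongrightarrow> 0" by (simp add: power_tendsto_0_iff)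
  thus ?thesis by (rule tendsto_norm_zero_cancel)
qed

section \<open>Passage to the limit\<close>

text \<open>By the Lipschitz estimate the pairs \<open>(ys j, us j)\<close> inherit the Cauchy
  property from \<open>xs\<close>, and the product space is complete.\<close>

lemma penalty_vi_convergent:
  assumes "Ly-lipschitz_on UNIV (partial_y F)" "Lu-lipschitz_on UNIV (partial_u F)" "\<beta> \<ge> 0" "\<alpha> > 0"
    and vi: "\<And>j. penalty_vi \<beta> \<alpha> (xs j) (ys j, us j)" and "xs \<longlonglongrightarrow> x"
  obtains y u where "ys \<longlonglongrightarrow> y" "us \<longlonglongrightarrow> u"
proof -
  obtain C where C: "C \<ge> 0" "\<And>x z x' z'. penalty_vi \<beta> \<alpha> x z \<Longrightarrow> penalty_vi \<beta> \<alpha> x' z' \<Longrightarrow>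
      norm (z - z') \<le> C * norm (x - x')"
    by (rule penalty_vi_lipschitz[OF assms(1-4)]) blast
  have "Cauchy (\<lambda>j. (ys j, us j))"
  proof (rule CauchyI)
    fix e :: real assume e: "e > 0"
    have "Cauchy xs" using assms(6) by (rule LIMSEQ_imp_Cauchy)
    moreover have "e / (C + 1) > 0" using e C(1) by simp
    ultimately obtain N where N: "\<And>i j. i \<ge> N \<Longrightarrow> j \<ge> N \<Longrightarrow> norm (xs i - xs j) < e / (C + 1)"
      using CauchyD[of xs "e / (C + 1)"] by blast
    have "norm ((ys i, us i) - (ys j, us j)) < e" if "i \<ge> N" "j \<ge> N" for i j
    proof -
      have "norm ((ys i, us i) - (ys j, us j)) \<le> C * norm (xs i - xs j)" by (rule C(2)[OF vi vi])
      also have "\<dots> \<le> C * (e / (C + 1))" using N[OF that] C(1) by (intro mult_left_mono) auto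
      also have "\<dots> < e" using e C(1) by (simp add: field_simps)
      finally show ?thesis .
    qed
    thus "\<exists>M. \<forall>m\<ge>M. \<forall>n\<ge>M. norm ((ys m, us m) - (ys n, us n)) < e" by blast
  qed
  then obtain l where l: "(\<lambda>j. (ys j, us j)) \<longlonglongrightarrow> l"
    using Cauchy_convergent convergent_def by blast
  show ?thesis
    by (rule that[of "fst l" "snd l"]) (use tendsto_fst[OF l] tendsto_snd[OF l] in simp_all)
qed

text \<open>The multipliers of the limit are \<open>a\<close> for the value function constraint, the
  negative reduced gradient for \<open>Xad\<close>, and those supplied by the limiting variational
  inequality. All convergences are strong, so every term passes to the limit.\<close>

lemma stationary_limit:
  assumes Lx: "Lx-lipschitz_on UNIV (partial_x F)" and Ly: "Ly-lipschitz_on UNIV (partial_y F)"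
    and Lu: "Lu-lipschitz_on UNIV (partial_u F)"
    and "\<eta> > 0" "a > 0" and xX: "\<And>j. xs j \<in> Xad"
    and vi: "\<And>j. penalty_vi 1 a (xs j) (ys j, us j)"
    and lim: "xs \<longlonglongrightarrow> x" "ys \<longlonglongrightarrow> y" "us \<longlonglongrightarrow> u" and next_lim: "(\<lambda>j. xs' j - xs j) \<longlonglongrightarrow> 0"
    and V: "(\<lambda>j. V (xs j, ys j, us j)) \<longlonglongrightarrow> 0"
    and proj: "\<And>j c. c \<in> Xad \<Longrightarrow>
      (xs j - \<eta> *\<^sub>R reduced_gradient a (xs j, ys j, us j) - xs' j) \<bullet> (c - xs' j) \<le> 0"
  shows "stationary_point (x, y, u)"
proof -
  have p: "(\<lambda>j. (xs j, ys j, us j)) \<longlonglongrightarrow> (x, y, u)" by (intro tendsto_Pair lim)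
  have lx: "(\<lambda>j. partial_x F (xs j, ys j, us j)) \<longlonglongrightarrow> partial_x F (x, y, u)"
    by (rule continuous_on_tendsto_compose[OF lipschitz_on_continuous_on[OF Lx] p]) auto
  obtain C where C: "C-lipschitz_on UNIV lower_solution" by (rule lower_solution_lipschitz[OF Ly Lu])
  have ls: "(\<lambda>j. lower_solution (xs j)) \<longlonglongrightarrow> lower_solution x"
    by (rule continuous_on_tendsto_compose[OF lipschitz_on_continuous_on[OF C] lim(1)]) auto
  hence yo: "(\<lambda>j. y_opt (xs j)) \<longlonglongrightarrow> y_opt x" unfolding y_opt_def by (rule tendsto_fst)
  have f_lim: "(\<lambda>j. f (xs j, zs j)) \<longlonglongrightarrow> f (x, l)" if "zs \<longlonglongrightarrow> l" for zs l
    unfolding f_def case_prod_beta fst_conv snd_conv by (intro tendsto_intros lim that)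
  have "(\<lambda>j. V (xs j, ys j, us j)) \<longlonglongrightarrow> V (x, y, u)"
    unfolding V_def case_prod_conv \<phi>_def
    by (rule tendsto_diff[OF tendsto_diff[OF f_lim[OF tendsto_Pair[OF lim(2,3)]] f_lim[OF ls]] tendsto_const])
  \<comment> \<open>The relaxed constraint is active in the limit, which settles both its
    feasibility and complementarity.\<close>
  hence V0: "V (x, y, u) = 0" using V by (rule LIMSEQ_unique)
  have vi': "penalty_vi 1 a x (y, u)" by (rule penalty_vi_limit[OF Ly Lu vi lim])
  have x: "x \<in> Xad"
    by (rule closed_sequentially[OF compact_imp_closed[OF Xad(3)] _ lim(1)]) (rule xX)
  have "(\<lambda>j. xs j + (xs' j - xs j)) \<longlonglongrightarrow> x + 0" by (intro tendsto_add lim next_lim)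
  hence lim': "xs' \<longlonglongrightarrow> x" by simp
  \<comment> \<open>Since \<open>xs\<close> and \<open>xs'\<close> have the same limit, the
    difference of consecutive iterates drops out of the projection inequality, and division by
    \<open>\<eta> > 0\<close> leaves the normal cone condition.\<close>
  have "- reduced_gradient a (x, y, u) \<bullet> (c - x) \<le> 0" if c: "c \<in> Xad" for c
  proof -
    have "(x - x) \<bullet> (c - x) - \<eta> * (partial_x F (x, y, u) \<bullet> (c - x) + a * ((J (y_opt x) - J y) \<bullet> E (c - x))) \<le> 0"
    proof (rule LIMSEQ_le_const2)
      show "(\<lambda>j. (xs j - xs' j) \<bullet> (c - xs' j) - \<eta> * (partial_x F (xs j, ys j, us j) \<bullet> (c - xs' j)
            + a * ((J (y_opt (xs j)) - J (ys j)) \<bullet> E (c - xs' j))))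
          \<longlonglongrightarrow> (x - x) \<bullet> (c - x) - \<eta> * (partial_x F (x, y, u) \<bullet> (c - x) + a * ((J (y_opt x) - J y) \<bullet> E (c - x)))"
        by (intro tendsto_intros lim lim' lx yo)
      have "(xs j - xs' j) \<bullet> (c - xs' j) - \<eta> * (partial_x F (xs j, ys j, us j) \<bullet> (c - xs' j)
            + a * ((J (y_opt (xs j)) - J (ys j)) \<bullet> E (c - xs' j))) \<le> 0" for j
        unfolding reduced_gradient_inner[symmetric] using proj[OF c, of j]
        by (simp add: inner_diff_left algebra_simps)
      thus "\<exists>N. \<forall>j\<ge>N. (xs j - xs' j) \<bullet> (c - xs' j) - \<eta> * (partial_x F (xs j, ys j, us j) \<bullet> (c - xs' j)
            + a * ((J (y_opt (xs j)) - J (ys j)) \<bullet> E (c - xs' j))) \<le> 0" by blast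
    qed
    thus ?thesis unfolding reduced_gradient_inner[symmetric] using assms(4) by (simp add: zero_le_mult_iff)
  qed
  hence "- reduced_gradient a (x, y, u) \<in> normal_cone Xad x" using x by (simp add: normal_cone_def)
  moreover have "0 = partial_x F (x, y, u) + - reduced_gradient a (x, y, u)
              + a *\<^sub>R (partial_x f (x, y, u) - E_adj (E x - J (y_opt x)))"
    by (simp add: reduced_gradient_def)
  moreover obtain lp lu where "lu \<in> normal_cone Uad u"
     "0 = partial_y F (x, y, u) + A_adj lp + a *\<^sub>R partial_y f (x, y, u)"
     "0 = partial_u F (x, y, u) - B_adj lp + lu + a *\<^sub>R partial_u f (x, y, u)"
    using vi' unfolding penalty_vi_iff_multipliers by blast
  moreover have "f (x, y, u) - \<phi> x - \<epsilon> = 0" using V0 by (simp add: V_def)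
  moreover from this have "ioc_feasible (x, y, u)"
    unfolding ioc_feasible_def using x penalty_vi_feasible[OF vi'] by simp
  ultimately show ?thesis
    unfolding stationary_point_def case_prod_conv using assms(5)
    by (intro conjI exI[of _ "- reduced_gradient a (x, y, u)"] exI[of _ lp] exI[of _ lu] exI[of _ a])
      simp_all
qed

section \<open>The two assertions about sequences generated by the algorithm\<close>

text \<open>Compactness of \<open>Xad\<close> selects a subsequence of the \<open>x k\<close>, and
  the lower-level variables converge along it, even strongly.\<close>

lemma penalty_sequence_weak_subsequence:
  assumes "Ly-lipschitz_on UNIV (partial_y F)" "Lu-lipschitz_on UNIV (partial_u F)"
    and "bdd_below (F ` (Xad \<times> (control_to_state ` Uad) \<times> Uad))"
    and "penalty_sequence x0 \<alpha>0 \<gamma> \<eta> \<kappa> z" "x0 \<in> Xad" "\<alpha>0 > 0" "\<gamma> > 1" "0 < \<kappa>" "\<kappa> < 1"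
  shows "\<exists>r l. strict_mono (r :: nat \<Rightarrow> nat) \<and> weakly_converges (z \<circ> r) l"
proof -
  obtain M where M: "\<And>\<alpha> x y u. x \<in> Xad \<Longrightarrow> \<alpha> \<ge> 0 \<Longrightarrow> penalty_vi 1 \<alpha> x (y, u) \<Longrightarrow> V (x, y, u) > 0 \<Longrightarrow> \<alpha> \<le> M"
    by (rule penalty_parameter_bounded[OF assms(1-3)]) blast
  obtain x y u a K where a: "0 < a" and z: "z = (\<lambda>k. (x k, y k, u k))" and x: "\<And>k. x k \<in> Xad"
    and vi: "\<And>k. k \<ge> K \<Longrightarrow> penalty_vi 1 a (x k) (y k, u k)"
    by (rule penalty_sequence_tail[OF assms(4-9)], rule M, assumption+, rule that)
  obtain r l where r: "strict_mono (r :: nat \<Rightarrow> nat)" and l: "(x \<circ> r) \<longlonglongrightarrow> l"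
    using Xad(3) x unfolding compact_def by blast
  \<comment> \<open>A strictly increasing \<open>r\<close> satisfies \<open>r n \<ge> n\<close>, so
    the shift by \<open>K\<close> keeps all indices in the range where the parameter is
    \<open>a\<close>.\<close>
  define r' where "r' j = r (j + K)" for j
  have r': "strict_mono r'" using r by (simp add: strict_mono_def r'_def)
  have lx: "(\<lambda>j. x (r' j)) \<longlonglongrightarrow> l"
    using LIMSEQ_ignore_initial_segment[OF l, of K] by (simp add: r'_def)
  have "r' j \<ge> K" for j using seq_suble[OF r, of "j + K"] by (simp add: r'_def)
  note vi' = vi[OF this]
  obtain y' u' where "(\<lambda>j. y (r' j)) \<longlonglongrightarrow> y'" "(\<lambda>j. u (r' j)) \<longlonglongrightarrow> u'"
    by (rule penalty_vi_convergent[OF assms(1,2) _ a vi' lx]) auto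
  hence "(z \<circ> r') \<longlonglongrightarrow> (l, y', u')" unfolding z comp_def by (intro tendsto_Pair lx)
  thus ?thesis using r' tendsto_imp_weakly_converges by blast
qed

lemma penalty_sequence_accumulation_point_stationary:
  assumes Lip: "Lx-lipschitz_on UNIV (partial_x F)" "Ly-lipschitz_on UNIV (partial_y F)" "Lu-lipschitz_on UNIV (partial_u F)"
    and bdd: "bdd_below (F ` (Xad \<times> (control_to_state ` Uad) \<times> Uad))"
    and par: "x0 \<in> Xad" "\<alpha>0 > 0" "\<gamma> > 1" "0 < \<kappa>" "\<kappa> < 1"
  shows "\<exists>\<eta>bar>0. \<forall>\<eta>. 0 < \<eta> \<and> \<eta> < \<eta>bar \<longrightarrow>
            (\<forall>z. penalty_sequence x0 \<alpha>0 \<gamma> \<eta> \<kappa> z \<longrightarrow>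
               (\<forall>l. weak_accumulation_point z l \<longrightarrow> stationary_point l))"
proof -
  obtain M where M: "\<And>\<alpha> x y u. x \<in> Xad \<Longrightarrow> \<alpha> \<ge> 0 \<Longrightarrow> penalty_vi 1 \<alpha> x (y, u) \<Longrightarrow> V (x, y, u) > 0 \<Longrightarrow> \<alpha> \<le> M"
    by (rule penalty_parameter_bounded[OF Lip(2,3) bdd]) blast
  \<comment> \<open>The bound on \<open>\<eta>\<close> is fixed before any run, hence before
    \<open>a\<close> is known, so \<open>M\<close> stands in for \<open>a\<close>. The absolute
    value is taken because the sign of \<open>M\<close> is not known at this point, and the summand
    1 makes \<open>L\<close> positive.\<close>
  define L where "L = Lx + \<bar>M\<bar> * (norm E)\<^sup>2 + 1"
  have L: "L > 0" using lipschitz_on_nonneg[OF Lip(1)] by (simp add: L_def add_nonneg_pos)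
  have "stationary_point l"
    if \<eta>: "0 < \<eta>" "\<eta> < 1 / L" and seq: "penalty_sequence x0 \<alpha>0 \<gamma> \<eta> \<kappa> z" and acc: "weak_accumulation_point z l" for \<eta> z l
  proof -
    obtain x y u a K where a: "0 < a" "a \<le> M" and z: "z = (\<lambda>k. (x k, y k, u k))" and x: "\<And>k. x k \<in> Xad"
      and vi: "\<And>k. k \<ge> K \<Longrightarrow> penalty_vi 1 a (x k) (y k, u k)" and V: "(\<lambda>k. V (z k)) \<longlonglongrightarrow> 0"
      and proj: "\<And>k c. k \<ge> K \<Longrightarrow> c \<in> Xad \<Longrightarrow> (x k - \<eta> *\<^sub>R reduced_gradient a (z k) - x (Suc k)) \<bullet> (c - x (Suc k)) \<le> 0"
      by (rule penalty_sequence_tail[OF seq par], rule M, assumption+, rule that)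
    have "Lx + a * (norm E)\<^sup>2 \<le> Lx + \<bar>M\<bar> * (norm E)\<^sup>2"
      using a by (intro add_left_mono mult_right_mono) auto
    hence "\<eta> * (Lx + a * (norm E)\<^sup>2) \<le> \<eta> * L" using \<eta>(1) by (intro mult_left_mono) (auto simp: L_def)
    also have "\<dots> < 1" using \<eta>(2) L by (simp add: field_simps)
    finally have step: "\<eta> * (Lx + a * (norm E)\<^sup>2) < 1" .
    have "(\<lambda>k. x (Suc k + K) - x (k + K)) \<longlonglongrightarrow> 0"
      by (rule projected_gradient_steps_vanish[OF Lip(1) a(1) \<eta>(1) step bdd, of "\<lambda>k. x (k + K)" "\<lambda>k. y (k + K)" "\<lambda>k. u (k + K)"])
        (use x vi proj z in auto)
    hence "(\<lambda>k. x (Suc (k + K)) - x (k + K)) \<longlonglongrightarrow> 0" by simp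
    hence steps: "(\<lambda>k. x (Suc k) - x k) \<longlonglongrightarrow> 0" by (rule LIMSEQ_offset)
    obtain r where r: "strict_mono (r :: nat \<Rightarrow> nat)" and wl: "weakly_converges (z \<circ> r) l"
      using acc unfolding weak_accumulation_point_def by blast
    define r' where "r' j = r (j + K)" for j
    have r': "strict_mono r'" using r by (simp add: strict_mono_def r'_def)
    have K: "r' j \<ge> K" for j using seq_suble[OF r, of "j + K"] by (simp add: r'_def)
    have wl': "weakly_converges (\<lambda>j. z (r' j)) l"
      using wl unfolding weakly_converges_def r'_def comp_def
      by (intro allI LIMSEQ_ignore_initial_segment) (rule spec)
    have lx: "(\<lambda>j. x (r' j)) \<longlonglongrightarrow> fst l"
      using weakly_converges_imp_tendsto[OF weakly_converges_fst[OF wl']] by (simp add: z)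
    obtain y' u' where lyu: "(\<lambda>j. y (r' j)) \<longlonglongrightarrow> y'" "(\<lambda>j. u (r' j)) \<longlonglongrightarrow> u'"
      by (rule penalty_vi_convergent[OF Lip(2,3) _ a(1) vi[OF K] lx]) auto
    have "(\<lambda>j. z (r' j)) \<longlonglongrightarrow> (fst l, y', u')" unfolding z by (intro tendsto_Pair lx lyu)
    \<comment> \<open>The weak limit \<open>l\<close> coincides with the strong limit along the same
      subsequence.\<close>
    hence l: "l = (fst l, y', u')"
      by (rule weakly_converges_unique[OF wl' tendsto_imp_weakly_converges])
    have sub: "(\<lambda>j. X (r' j)) \<longlonglongrightarrow> 0" if "X \<longlonglongrightarrow> 0" for X :: "nat \<Rightarrow> 'c::real_normed_vector"
      using LIMSEQ_subseq_LIMSEQ[OF that r'] by (simp add: comp_def)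
    have "stationary_point (fst l, y', u')"
      by (rule stationary_limit[OF Lip \<eta>(1) a(1) x vi[OF K] lx lyu sub[OF steps]])
        (use sub[OF V] proj[OF K] z in auto)
    thus ?thesis using l by simp
  qed
  thus ?thesis using L by (intro exI[of _ "1 / L"]) auto
qed

end

theorem theorem4p11:
  fixes F :: "(real^'n) \<times> 'y::{real_inner,complete_space} \<times> 'u::{real_inner,complete_space} \<Rightarrow> real"
    and J :: "'y \<Rightarrow>\<^sub>L 'v::{real_inner,complete_space}"
    and A :: "'y \<Rightarrow>\<^sub>L ('y \<Rightarrow>\<^sub>L real)"
    and B :: "'u \<Rightarrow>\<^sub>L ('y \<Rightarrow>\<^sub>L real)"
    and E :: "(real^'n) \<Rightarrow>\<^sub>L 'v"
    and Xad :: "(real^'n) set"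
    and Uad :: "'u set"
    and \<sigma> \<epsilon> \<alpha>0 \<gamma> \<kappa> :: real
    and x0 :: "real^'n"
  assumes "ioc_problem F J A Xad Uad \<sigma> \<epsilon>"
    and "bdd_below (F ` (Xad \<times> (ioc_problem.control_to_state A B ` Uad) \<times> Uad))"
    and "\<exists>L. lipschitz_on L UNIV (partial_x F)"
    and "\<exists>L. lipschitz_on L UNIV (partial_y F)"
    and "\<exists>L. lipschitz_on L UNIV (partial_u F)"
    and "x0 \<in> Xad" "\<alpha>0 > 0" "\<gamma> > 1" "0 < \<kappa>" "\<kappa> < 1"
  shows "(\<forall>\<eta>>0. \<forall>z. ioc_problem.penalty_sequence F J A B E Xad Uad \<sigma> \<epsilon> x0 \<alpha>0 \<gamma> \<eta> \<kappa> z \<longrightarrow>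
            (\<exists>r l. strict_mono (r :: nat \<Rightarrow> nat) \<and> weakly_converges (z \<circ> r) l))
       \<and> (\<exists>\<eta>bar>0. \<forall>\<eta>. 0 < \<eta> \<and> \<eta> < \<eta>bar \<longrightarrow>
            (\<forall>z. ioc_problem.penalty_sequence F J A B E Xad Uad \<sigma> \<epsilon> x0 \<alpha>0 \<gamma> \<eta> \<kappa> z \<longrightarrow>
               (\<forall>l. weak_accumulation_point z l \<longrightarrow>
                  ioc_problem.stationary_point F J A B E Xad Uad \<sigma> \<epsilon> l)))"
proof -
  interpret ioc_problem F J A B E Xad Uad \<sigma> \<epsilon> by fact
  obtain Lx Ly Lu where "Lx-lipschitz_on UNIV (partial_x F)" "Ly-lipschitz_on UNIV (partial_y F)"
      "Lu-lipschitz_on UNIV (partial_u F)"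
    using assms(3-5) by blast
  note Lip = this
  show ?thesis
  proof (rule conjI)
    show "\<forall>\<eta>>0. \<forall>z. penalty_sequence x0 \<alpha>0 \<gamma> \<eta> \<kappa> z \<longrightarrow>
        (\<exists>r l. strict_mono (r :: nat \<Rightarrow> nat) \<and> weakly_converges (z \<circ> r) l)"
      using penalty_sequence_weak_subsequence[OF Lip(2,3) assms(2) _ assms(6-10)] by blast
    show "\<exists>\<eta>bar>0. \<forall>\<eta>. 0 < \<eta> \<and> \<eta> < \<eta>bar \<longrightarrow>
        (\<forall>z. penalty_sequence x0 \<alpha>0 \<gamma> \<eta> \<kappa> z \<longrightarrow>
           (\<forall>l. weak_accumulation_point z l \<longrightarrow> stationary_point l))"
      by (rule penalty_sequence_accumulation_point_stationary[OF Lip assms(2,6-10)])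
  qed
qed

end
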